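(* Let $M_m$ be a von Mangoldt plane and let $0<x<y$ be such that $m'>0$ on $[0,y]$ and $m'<\tfrac12$ on $[x,y]$. Let $b$ be the maximum of $m'$ on $[x,y]$ and set $f_{m,x}(y):=m^{-1}(\cos(\pi b)\,m(y))$, where $m^{-1}$ is the inverse of the increasing function $m|_{[0,y]}$. If $x\le f_{m,x}(y)$, then $r(\mathfrak C_m)$ and $[x,f_{m,x}(y)]$ are disjoint.
   Context: For a smooth function $m\colon[0,\infty)\to[0,\infty)$ with $m(0)=0$, $m'(0)=1$, $m>0$ on $(0,\infty)$ and smooth odd extension, $M_m$ is $\mathbb R^2$ with metric $dr^2+m(r)^2d\theta^2$ (polar coordinates about origin $o$; $r$ is distance to $o$), curvature $G_m=-m''/m$; von Mangoldt means $G_m$ non-increasing in $r$. A ray is a unit speed geodesic on $[0,\infty)$ minimizing between any two of its points. $\mathfrak C_m$ is the set of points $q$ such that every unit tangent vector at $q$ makes angle $\le\pi/2$ with some ray from $q$. *)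

theory Defs
  imports "HOL-Analysis.Analysis"
begin

text \<open>The plane R^2 is modelled by complex numbers; the pole o is 0 and the
polar radius r of a point p is norm p.\<close>

definition smooth_fun :: "(real \<Rightarrow> real) \<Rightarrow> bool" where
  "smooth_fun M \<longleftrightarrow> (\<forall>k x. ((deriv ^^ k) M) differentiable (at x))"

text \<open>Admissible profile: m is (the odd extension of) a smooth function with
m 0 = 0, m'(0) = 1 and m > 0 on (0, infinity).\<close>
definition profile :: "(real \<Rightarrow> real) \<Rightarrow> bool" where
  "profile m \<longleftrightarrow> smooth_fun m \<and> (\<forall>x. m (-x) = - m x) \<and> m 0 = 0 \<and>
     deriv m 0 = 1 \<and> (\<forall>r>0. m r > 0)"

definition curv :: "(real \<Rightarrow> real) \<Rightarrow> real \<Rightarrow> real" where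
  "curv m r = - deriv (deriv m) r / m r"

definition von_mangoldt :: "(real \<Rightarrow> real) \<Rightarrow> bool" where
  "von_mangoldt m \<longleftrightarrow> profile m \<and> (\<forall>r s. 0 < r \<longrightarrow> r \<le> s \<longrightarrow> curv m s \<le> curv m r)"

text \<open>Riemannian metric dr^2 + m(r)^2 dtheta^2 written in Cartesian coordinates:
for p \<noteq> 0 with u = p / |p| (radial unit vector) and i*u (angular unit vector),
g_p(v,w) = (v.u)(w.u) + (m(r)/r)^2 (v.iu)(w.iu); at the pole it is Euclidean.\<close>
definition gmet :: "(real \<Rightarrow> real) \<Rightarrow> complex \<Rightarrow> complex \<Rightarrow> complex \<Rightarrow> real" where
  "gmet m p v w =
     (if p = 0 then inner v w
      else (let r = norm p; u = p / of_real r in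
              (inner v u) * (inner w u) + (m r / r)\<^sup>2 * (inner v (\<i> * u)) * (inner w (\<i> * u))))"

definition mlength :: "(real \<Rightarrow> real) \<Rightarrow> (real \<Rightarrow> complex) \<Rightarrow> real" where
  "mlength m g = integral {0..1}
     (\<lambda>t. sqrt (gmet m (g t) (vector_derivative g (at t)) (vector_derivative g (at t))))"

definition mdist :: "(real \<Rightarrow> real) \<Rightarrow> complex \<Rightarrow> complex \<Rightarrow> real" where
  "mdist m p q = Inf {mlength m g | g. g C1_differentiable_on {0..1} \<and> g 0 = p \<and> g 1 = q}"

text \<open>A ray: a curve on [0,infinity) minimizing between any two of its points with
unit speed, i.e. d(gamma s, gamma t) = |s - t| (such curves are unit speed geodesics).\<close>
definition is_ray :: "(real \<Rightarrow> real) \<Rightarrow> (real \<Rightarrow> complex) \<Rightarrow> bool" where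
  "is_ray m \<gamma> \<longleftrightarrow> (\<forall>t\<ge>0. \<gamma> differentiable (at t within {0..})) \<and>
     (\<forall>s\<ge>0. \<forall>t\<ge>0. mdist m (\<gamma> s) (\<gamma> t) = \<bar>s - t\<bar>)"

definition mangle :: "(real \<Rightarrow> real) \<Rightarrow> complex \<Rightarrow> complex \<Rightarrow> complex \<Rightarrow> real" where
  "mangle m q v w = arccos (gmet m q v w / (sqrt (gmet m q v v) * sqrt (gmet m q w w)))"

definition Cset :: "(real \<Rightarrow> real) \<Rightarrow> complex set" where
  "Cset m = {q. \<forall>v. gmet m q v v = 1 \<longrightarrow>
     (\<exists>\<gamma>. is_ray m \<gamma> \<and> \<gamma> 0 = q \<and>
        mangle m q v (vector_derivative \<gamma> (at 0 within {0..})) \<le> pi / 2)}"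

definition fmx :: "(real \<Rightarrow> real) \<Rightarrow> real \<Rightarrow> real \<Rightarrow> real" where
  "fmx m x y = the_inv_into {0..y} m (cos (pi * Sup (deriv m ` {x..y})) * m y)"

end

theory Submission
  imports Defs
begin

text \<open>
Let \<open>q\<close> have radius \<open>a\<close> in the given interval, and let \<open>b\<close> be the maximum of \<open>m'\<close> on \<open>[x, y]\<close>. By
Clairaut's relation a geodesic with constant \<open>c\<close> that starts at \<open>q\<close> and does not point outward turns,
up to the radius \<open>y\<close>, by twice the integral of \<open>c / (m sqrt (m\<^sup>2 - c\<^sup>2))\<close> from the smallest radius to \<open>a\<close>
plus once the integral from \<open>a\<close> to \<open>y\<close>. The von Mangoldt condition says that \<open>m'\<^sup>2\<close> is a convex function
of \<open>m\<^sup>2\<close>, so \<open>m'\<close> is at most its value for a spherical cap up to radius \<open>a\<close>, and at most \<open>b\<close> (the value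
for a cone) from \<open>a\<close> to \<open>y\<close>. For the cap followed by the cone the turning angle is elementary, and
\<open>m a \<le> cos (\<pi> b) m y\<close> makes it at least \<open>\<pi>\<close>. Such a geodesic therefore is no ray.

In metric terms: write a near-minimal curve to a far point of a ray as a part inside the disc of a radius \<open>Y\<close>
slightly larger than \<open>y\<close>, followed by the rest. If the exit point from the disc is seen under the angle
\<open>\<theta> \<le> \<pi>\<close>, some outward geodesic with constant \<open>c < m a\<close> joins \<open>q\<close> to it and has length
\<open>c \<theta> + \<integral> sqrt (1 - c\<^sup>2 / m\<^sup>2)\<close>. Calibrations bound the part inside the disc from below, also when it first
approaches the pole, because the derivative in \<open>c\<close> of the length for the latter curves is \<open>\<theta>\<close>
minus the turning angle and hence is at most zero. Starting the ray inward or tangentially would therefore shorten the distance to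
far points at a rate of at most about \<open>c / m a < 1\<close>, whereas along a ray the rate is one.
\<close>

section \<open>The turning angle over a spherical cap and a cone\<close>

text \<open>With \<open>k = 1 / b\<^sup>2 - 1\<close> and \<open>\<mu> = cos (\<pi> b)\<close>, the function \<open>N (sin \<psi>) / b\<close> is the derivative in \<open>\<psi>\<close>
  of the left-hand side of \<open>turn_angle_ge_pi_trig\<close>; after squaring, its sign is that of a function affine
  in \<open>s\<^sup>2\<close>, hence changes only once.\<close>

lemma slope_sign_once:
  fixes k \<mu> s1 s2 :: real
  defines "N \<equiv> \<lambda>s. 2 / (1 + s\<^sup>2 * k) - 1 + \<mu> * s / sqrt (1 - \<mu>\<^sup>2 + \<mu>\<^sup>2 * s\<^sup>2)"
  assumes k: "k > 0" and \<mu>: "0 < \<mu>" "\<mu> < 1" and s: "0 < s1" "s1 < s2" and neg: "N s1 < 0"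
  shows "N s2 \<le> 0"
proof (rule ccontr)
  have \<mu>2: "\<mu>\<^sup>2 < 1" using \<mu> by (simp add: power_less_one_iff)
  have char: "(N s < 0) = (s\<^sup>2*k > 1 \<and> 4 * \<mu>\<^sup>2 * k * (s\<^sup>2)\<^sup>2 < (1 - \<mu>\<^sup>2) * (s\<^sup>2 * k - 1)\<^sup>2)"
    and char': "(N s > 0) = (\<not> (s\<^sup>2*k > 1 \<and> 4 * \<mu>\<^sup>2 * k * (s\<^sup>2)\<^sup>2 \<le> (1 - \<mu>\<^sup>2) * (s\<^sup>2 * k - 1)\<^sup>2))"
    if s: "s > 0" for s
  proof -
    define u where "u = s\<^sup>2"
    define r where "r = sqrt (1 - \<mu>\<^sup>2 + \<mu>\<^sup>2 * u)"
    have u: "u > 0" using s by (simp add: u_def)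
    have rad: "1 - \<mu>\<^sup>2 + \<mu>\<^sup>2 * u > 0" using \<mu>2 u by (smt (verit) zero_le_power2 mult_nonneg_nonneg)
    have r: "r > 0" "r\<^sup>2 = 1 - \<mu>\<^sup>2 + \<mu>\<^sup>2 * u" using rad by (auto simp: r_def)
    have uk: "1 + u * k > 0" using u k by (simp add: add_pos_pos)
    have Nn: "N s = (\<mu> * s * (1 + u*k) - (u*k - 1) * r) / ((1 + u * k) * r)"
      using uk r unfolding N_def u_def[symmetric] r_def[symmetric]
      by (simp add: divide_simps) (simp add: algebra_simps)
    have dpos: "(1 + u * k) * r > 0" using uk r by simp
    \<comment> \<open>The numerator of \<open>N s\<close> is \<open>a - d\<close> with
      \<open>a\<close> positive, so its sign is decided by the sign of \<open>d\<close> and by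
      comparing squares.\<close>
    define a where "a = \<mu> * s * (1 + u*k)"
    define d where "d = (u*k - 1) * r"
    have a: "a > 0" unfolding a_def using \<mu> s uk by simp
    have sq: "d\<^sup>2 - a\<^sup>2 = (1 - \<mu>\<^sup>2) * (u * k - 1)\<^sup>2 - 4 * \<mu>\<^sup>2 * k * u\<^sup>2"
      unfolding a_def d_def power_mult_distrib r(2) u_def[symmetric]
      by (simp add: power2_eq_square algebra_simps)
    have dp: "d > 0 \<longleftrightarrow> u*k > 1" unfolding d_def using r(1) by (simp add: zero_less_mult_iff)
    have 1: "a < d \<longleftrightarrow> d > 0 \<and> a\<^sup>2 < d\<^sup>2" using a
      by (smt (verit) power2_less_imp_less power_strict_mono zero_less_numeral)
    have 2: "d < a \<longleftrightarrow> \<not> (d > 0 \<and> a\<^sup>2 \<le> d\<^sup>2)" using a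
      by (smt (verit) power2_le_imp_le power_mono)
    have "N s < 0 \<longleftrightarrow> a < d" unfolding Nn a_def d_def using dpos by (simp add: divide_less_0_iff)
    then show "(N s < 0) = (s\<^sup>2*k > 1 \<and> 4 * \<mu>\<^sup>2 * k * (s\<^sup>2)\<^sup>2 < (1 - \<mu>\<^sup>2) * (s\<^sup>2 * k - 1)\<^sup>2)"
      unfolding 1 dp using sq by (auto simp: u_def)
    have "N s > 0 \<longleftrightarrow> d < a" unfolding Nn a_def d_def using dpos by (simp add: zero_less_divide_iff)
    then show "(N s > 0) = (\<not> (s\<^sup>2*k > 1 \<and> 4 * \<mu>\<^sup>2 * k * (s\<^sup>2)\<^sup>2 \<le> (1 - \<mu>\<^sup>2) * (s\<^sup>2 * k - 1)\<^sup>2))"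
      unfolding 2 dp using sq by (auto simp: u_def)
  qed
  assume "\<not> N s2 \<le> 0"
  then have pos: "N s2 > 0" by simp
  define u v where "u = s1\<^sup>2" and "v = s2\<^sup>2"
  have uv: "0 < u" "u < v" using s by (auto simp: u_def v_def power_strict_mono)
  have u1: "u * k > 1" and u2: "4 * \<mu>\<^sup>2 * k * u\<^sup>2 < (1 - \<mu>\<^sup>2) * (u * k - 1)\<^sup>2"
    using char[OF s(1)] neg by (auto simp: u_def)
  have v1: "v * k > 1" using u1 uv k by (smt (verit) mult_strict_right_mono)
  \<comment> \<open>The quotient (u k - 1) / u increases with u. Cleared of denominators and
    squared, this carries the inequality from \<open>u\<close> to \<open>v\<close>.\<close>
  have "v * (u * k - 1) \<le> u * (v * k - 1)" using uv by (simp add: algebra_simps)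
  then have "(v * (u * k - 1))\<^sup>2 \<le> (u * (v * k - 1))\<^sup>2"
    using uv u1 by (intro power_mono) auto
  then have le: "v\<^sup>2 * (u * k - 1)\<^sup>2 \<le> u\<^sup>2 * (v * k - 1)\<^sup>2" by (simp add: power_mult_distrib)
  have "4 * \<mu>\<^sup>2 * k * v\<^sup>2 * u\<^sup>2 = v\<^sup>2 * (4 * \<mu>\<^sup>2 * k * u\<^sup>2)" by simp
  also have "\<dots> \<le> v\<^sup>2 * ((1 - \<mu>\<^sup>2) * (u * k - 1)\<^sup>2)" using u2 by (intro mult_left_mono) auto
  also have "\<dots> = (1 - \<mu>\<^sup>2) * (v\<^sup>2 * (u * k - 1)\<^sup>2)" by simp
  also have "\<dots> \<le> (1 - \<mu>\<^sup>2) * (u\<^sup>2 * (v * k - 1)\<^sup>2)" using le \<mu>2 by (intro mult_left_mono) auto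
  finally have "4 * \<mu>\<^sup>2 * k * v\<^sup>2 \<le> (1 - \<mu>\<^sup>2) * (v * k - 1)\<^sup>2"
    using uv(1) mult_right_le_imp_le[of "4 * \<mu>\<^sup>2 * k * v\<^sup>2" "u\<^sup>2"] by (simp add: mult_ac)
  then show False using char'[of s2] s pos v1 by (simp add: v_def)
qed

text \<open>The left-hand side extends to \<open>\<psi> = 0\<close> and \<open>\<psi> = \<pi> / 2\<close> with value \<open>\<pi>\<close>, and it first increases and then
  possibly decreases. At \<open>\<pi> / 2\<close> the formula has to be rewritten with \<open>cot\<close>, as \<open>tan (\<pi> / 2)\<close> is junk.\<close>

lemma turn_angle_ge_pi_trig:
  fixes b \<psi> :: real
  assumes b: "0 < b" "b < 1/2" and \<psi>: "0 < \<psi>" "\<psi> < pi/2"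
  shows "2 * arctan (tan \<psi> / b) + (arccos (cos (pi * b) * cos \<psi>) - \<psi>) / b \<ge> pi"
proof (rule ccontr)
  define \<mu> where "\<mu> = cos (pi * b)"
  have pb: "0 < pi * b" "pi * b < pi / 2" using b by auto
  have \<mu>: "0 < \<mu>" "\<mu> < 1"
    unfolding \<mu>_def using pb cos_gt_zero_pi[of "pi*b"] cos_monotone_0_pi[of 0 "pi*b"] by auto
  define k where "k = 1 / b\<^sup>2 - 1"
  have "b\<^sup>2 < 1" using b by (simp add: power_less_one_iff)
  then have k: "k > 0" unfolding k_def using b by (simp add: field_simps)
  define h1 where "h1 = (\<lambda>\<psi>. 2 * arctan (tan \<psi> / b) + (arccos (\<mu> * cos \<psi>) - \<psi>) / b)"
  define h2 where "h2 = (\<lambda>\<psi>. pi - 2 * arctan (b * cot \<psi>) + (arccos (\<mu> * cos \<psi>) - \<psi>) / b)"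
  define N where "N = (\<lambda>s. 2 / (1 + s\<^sup>2 * k) - 1 + \<mu> * s / sqrt (1 - \<mu>\<^sup>2 + \<mu>\<^sup>2 * s\<^sup>2))"
  assume "\<not> ?thesis"
  then have lt: "h1 \<psi> < pi" by (simp add: h1_def \<mu>_def)
  have bd: "\<bar>\<mu> * cos t\<bar> < 1" for t
  proof -
    have "\<mu> * \<bar>cos t\<bar> \<le> \<mu> * 1" using \<mu> by (intro mult_left_mono) auto
    moreover have "\<bar>\<mu> * cos t\<bar> = \<mu> * \<bar>cos t\<bar>" using \<mu> by (simp add: abs_mult)
    ultimately show ?thesis using \<mu> by linarith
  qed
  have d1: "(h1 has_real_derivative N (sin t) / b) (at t)" if t: "0 \<le> t" "t < pi/2" for t
  proof -
    have c: "cos t > 0" using t cos_gt_zero_pi[of t] by auto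
    have s1: "1 - (\<mu> * cos t)\<^sup>2 = 1 - \<mu>\<^sup>2 + \<mu>\<^sup>2 * (sin t)\<^sup>2"
      unfolding sin_squared_eq by (simp add: power_mult_distrib algebra_simps)
    have s2: "inverse ((cos t)\<^sup>2) / b / (1 + (tan t / b)\<^sup>2) = (1 / (1 + (sin t)\<^sup>2 * k)) / b"
    proof -
      have p: "(cos t)\<^sup>2 * b\<^sup>2 + (sin t)\<^sup>2 > 0" using c b by (simp add: add_pos_nonneg)
      have e1: "1 + (tan t / b)\<^sup>2 = ((cos t)\<^sup>2 * b\<^sup>2 + (sin t)\<^sup>2) / ((cos t)\<^sup>2 * b\<^sup>2)"
        using c b by (simp add: tan_def field_simps)
      have e2: "1 + (sin t)\<^sup>2 * k = ((cos t)\<^sup>2 * b\<^sup>2 + (sin t)\<^sup>2) / b\<^sup>2"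
        unfolding k_def cos_squared_eq using b by (simp add: field_simps)
      show ?thesis unfolding e1 e2 using c b p by (simp add: field_simps)
    qed
    have "(h1 has_real_derivative (2 * (inverse ((cos t)\<^sup>2) / b / (1 + (tan t / b)\<^sup>2))
       + (\<mu> * sin t / sqrt (1 - (\<mu> * cos t)\<^sup>2) - 1) / b)) (at t)"
      unfolding h1_def using c b bd[of t]
      by (auto intro!: derivative_eq_intros simp: abs_less_iff field_simps)
    then show ?thesis unfolding s1 s2 N_def by (rule DERIV_cong) (simp add: add_divide_distrib diff_divide_distrib)
  qed
  have d2: "(h2 has_real_derivative N (sin t) / b) (at t)" if t: "0 < t" "t < pi/2" for t
  proof (rule has_field_derivative_transform_within_open[OF d1, of t "{0<..<pi/2}"])
    fix u :: real assume u: "u \<in> {0<..<pi/2}"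
    have c: "cos u > 0" "sin u > 0" using u cos_gt_zero_pi[of u] sin_gt_zero[of u] by auto
    have "arctan (tan u / b) + arctan (b * cot u) = pi / 2"
      using arctan_inverse[of "tan u / b"] c b by (auto simp: tan_def cot_def field_simps sgn_if)
    then show "h1 u = h2 u" unfolding h1_def h2_def by simp
  qed (use t in auto)
  have "arctan (tan \<psi> / b) + arctan (b * cot \<psi>) = pi / 2"
    using arctan_inverse[of "tan \<psi> / b"] \<psi> cos_gt_zero_pi[of \<psi>] sin_gt_zero[of \<psi>] b
    by (auto simp: tan_def cot_def field_simps sgn_if)
  then have lt2: "h2 \<psi> < pi" using lt unfolding h1_def h2_def by simp
  have h10: "h1 0 = pi" unfolding h1_def \<mu>_def using pb b by (simp add: arccos_cos)
  have h2e: "h2 (pi/2) = pi" unfolding h2_def by (simp add: cot_def)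
  \<comment> \<open>A value below pi at \<open>\<psi>\<close>, against the value pi at both ends,
    forces a negative slope to the left of \<open>\<psi>\<close> and a positive one to the right,
    the order that \<open>slope_sign_once\<close> excludes.\<close>
  obtain t1 where t1: "0 < t1" "t1 < \<psi>" "h1 \<psi> - h1 0 = (\<psi> - 0) * (N (sin t1) / b)"
    using MVT2[of 0 \<psi> h1 "\<lambda>t. N (sin t) / b"] d1 \<psi> by auto
  have "N (sin t1) / b < 0" using t1(3) h10 lt \<psi> by (smt (verit) mult_nonneg_nonneg)
  then have n1: "N (sin t1) < 0" using b by (simp add: divide_less_0_iff)
  have ch2: "continuous_on {\<psi>..pi/2} h2"
  proof -
    have "sin t \<noteq> 0" if "t \<in> {\<psi>..pi/2}" for t
      using that \<psi> sin_gt_zero[of t] by auto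
    moreover have "- 1 \<le> \<mu> * cos t \<and> \<mu> * cos t \<le> 1" for t using bd[of t] by linarith
    ultimately show ?thesis unfolding h2_def cot_def using b by (intro continuous_intros) auto
  qed
  obtain l t2 where t2: "\<psi> < t2" "t2 < pi/2" "(h2 has_real_derivative l) (at t2)" "h2 (pi/2) - h2 \<psi> = (pi/2 - \<psi>) * l"
    using MVT[OF \<psi>(2) ch2] d2 \<psi> real_differentiable_def by (smt (verit))
  have "l = N (sin t2) / b" using DERIV_unique[OF t2(3) d2] t2 \<psi> by auto
  then have "N (sin t2) / b > 0" using t2(4) h2e lt2 \<psi> by (smt (verit) mult_nonneg_nonpos)
  then have n2: "N (sin t2) > 0" using b by (simp add: zero_less_divide_iff)
  have "N (sin t2) \<le> 0"
    using slope_sign_once[of k \<mu> "sin t1" "sin t2"] k \<mu> n1 t1 t2 \<psi> sin_gt_zero[of t1] sin_monotone_2pi[of t1 t2]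
    unfolding N_def by auto
  then show False using n2 by simp
qed

text \<open>The substitution psi = arccos (c / M) reduces this to
  \<open>turn_angle_ge_pi_trig\<close>. The hypothesis on \<open>M\<close> and \<open>N\<close>
  enters through the monotonicity of arccos only. Here \<open>M\<close> and \<open>N\<close> stand
  for the values of the profile at the end of the cap and at the end of the cone.\<close>

lemma turn_angle_ge_pi:
  fixes b c M N :: real
  assumes b: "0 < b" "b < 1/2" and c: "0 < c" "c < M" and MN: "M \<le> cos (pi * b) * N"
  shows "2 * arctan (sqrt (M\<^sup>2 - c\<^sup>2) / (c * b)) + (arccos (c / N) - arccos (c / M)) / b \<ge> pi"
proof -
  define \<psi> where "\<psi> = arccos (c / M)"
  have cM: "0 < c / M" "c / M < 1" using c by auto
  have cos: "cos \<psi> = c / M" unfolding \<psi>_def using cM by (intro cos_arccos) auto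
  have \<psi>: "0 < \<psi>" "\<psi> < pi / 2"
    using arccos_lt_bounded[of "c/M"] arccos_less_arccos[of 0 "c/M"] cM by (auto simp: \<psi>_def)
  have "tan \<psi> = sqrt (1 - (c/M)\<^sup>2) / (c / M)"
    unfolding tan_def cos unfolding \<psi>_def using cM by (subst sin_arccos) auto
  also have "1 - (c/M)\<^sup>2 = (M\<^sup>2 - c\<^sup>2) / M\<^sup>2" using c by (simp add: field_simps)
  finally have tan: "tan \<psi> = sqrt (M\<^sup>2 - c\<^sup>2) / c" using c by (simp add: real_sqrt_divide)
  have pb: "0 < pi * b" "pi * b < pi / 2" using b by auto
  have cp: "cos (pi * b) > 0" using pb cos_gt_zero_pi[of "pi*b"] by auto
  have N: "N > 0" using MN c cp by (smt (verit) zero_less_mult_pos)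
  have "c / N \<le> cos (pi*b) * (c / M)" using MN c N
    by (simp add: field_simps) 
  moreover have "cos (pi*b) * (c / M) \<le> 1" using cp cM by (smt (verit) cos_le_one mult_le_one)
  ultimately have "arccos (cos (pi*b) * cos \<psi>) \<le> arccos (c / N)"
    unfolding cos using c N by (intro arccos_le_arccos) (auto intro: order_trans[of _ 0])
  then have "(arccos (cos (pi*b) * cos \<psi>) - \<psi>) / b \<le> (arccos (c / N) - arccos (c / M)) / b"
    using b by (simp add: \<psi>_def divide_right_mono)
  then show ?thesis
    using turn_angle_ge_pi_trig[OF b \<psi>] unfolding tan by simp
qed

text \<open>Radial action integrals in closed form: antiderivatives in \<open>s\<close> of \<open>sqrt (1 - (c / s)\<^sup>2) / m'\<close>, where \<open>s = m r\<close>
  and \<open>m'\<close> is \<open>sqrt (1 - k s\<^sup>2)\<close> (sphere of curvature \<open>k\<close>) or \<open>1\<close> (plane).\<close>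

definition cap_action :: "real \<Rightarrow> real \<Rightarrow> real \<Rightarrow> real" where
  "cap_action k c s = arccos (sqrt (1 - k * s\<^sup>2) / sqrt (1 - k * c\<^sup>2)) / sqrt k
     - c * arctan (sqrt (s\<^sup>2 - c\<^sup>2) / (c * sqrt (1 - k * s\<^sup>2)))"

definition flat_action :: "real \<Rightarrow> real \<Rightarrow> real" where
  "flat_action c s = sqrt (s\<^sup>2 - c\<^sup>2) - c * arccos (c / s)"

text \<open>The derivative in \<open>c\<close> is minus the angle swept from the turning radius up
  to \<open>s\<close>: the integrand of the action vanishes at the turning radius, so the moving end
  point contributes nothing.\<close>

lemma cap_action_derivs:
  fixes k c s :: real
  assumes k: "0 < k" and c: "0 < c" "c < s" and ks: "k * s\<^sup>2 < 1"
  shows cap_action_deriv_radius: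
      "(cap_action k c has_real_derivative sqrt (1 - (c / s)\<^sup>2) / sqrt (1 - k * s\<^sup>2)) (at s)"
    and cap_action_deriv_const:
      "((\<lambda>c. cap_action k c s) has_real_derivative
         - arctan (sqrt (s\<^sup>2 - c\<^sup>2) / (c * sqrt (1 - k * s\<^sup>2)))) (at c)"
proof -
  define A where "A = sqrt (1 - k * s\<^sup>2)"
  define C where "C = sqrt (1 - k * c\<^sup>2)"
  define Q where "Q = sqrt (s\<^sup>2 - c\<^sup>2)"
  define K where "K = sqrt k"
  have sc: "c\<^sup>2 < s\<^sup>2" using c by (simp add: power_strict_mono)
  have kc: "k * c\<^sup>2 < 1" using mult_strict_left_mono[OF sc k] ks by linarith
  have pos: "0 < A" "0 < C" "0 < Q" "0 < K" "0 < s"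
    using ks kc sc k c by (auto simp: A_def C_def Q_def K_def)
  have A2: "A\<^sup>2 = 1 - K\<^sup>2 * s\<^sup>2" and C2: "C\<^sup>2 = 1 - K\<^sup>2 * c\<^sup>2" and Q2: "Q\<^sup>2 = s\<^sup>2 - c\<^sup>2" and K2: "K\<^sup>2 = k"
    using ks kc sc k by (auto simp: A_def C_def Q_def K_def)
  \<comment> \<open>These two identities evaluate the expressions 1 - (A / C)^2 and 1 + (Q / (c
    A))^2 that arise on differentiating arccos and arctan.\<close>
  have CA: "C\<^sup>2 - A\<^sup>2 = K\<^sup>2 * Q\<^sup>2" unfolding A2 C2 Q2 by (simp add: algebra_simps)
  have cA: "c\<^sup>2 * A\<^sup>2 + Q\<^sup>2 = s\<^sup>2 * C\<^sup>2" unfolding A2 C2 Q2 by (simp add: algebra_simps)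
  have AC1: "A / C < 1" using pos CA by (smt (verit) divide_less_eq_1_pos mult_pos_pos power2_less_imp_less zero_less_power)
  have AC0: "-1 < A / C" using pos by (smt (verit) divide_pos_pos)
  have "1 - (A / C)\<^sup>2 = (C\<^sup>2 - A\<^sup>2) / C\<^sup>2" using pos by (simp add: field_simps)
  then have "1 - (A / C)\<^sup>2 = (K * Q / C)\<^sup>2"
    unfolding CA by (simp add: power_divide power_mult_distrib)
  then have rt: "sqrt (1 - (A / C)\<^sup>2) = K * Q / C" using pos by simp
  have at: "1 + (Q / (c * A))\<^sup>2 = s\<^sup>2 * C\<^sup>2 / (c * A)\<^sup>2"
    using cA pos c by (simp add: power_divide power_mult_distrib field_simps)
  have dA: "((\<lambda>s. sqrt (1 - k * s\<^sup>2)) has_real_derivative - (K\<^sup>2 * s / A)) (at s)"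
    unfolding A_def K2 using ks by (auto intro!: derivative_eq_intros simp: field_simps)
  have dC: "((\<lambda>c. sqrt (1 - k * c\<^sup>2)) has_real_derivative - (K\<^sup>2 * c / C)) (at c)"
    unfolding C_def K2 using ks kc by (auto intro!: derivative_eq_intros simp: field_simps)
  have dQs: "((\<lambda>s. sqrt (s\<^sup>2 - c\<^sup>2)) has_real_derivative s / Q) (at s)"
    unfolding Q_def using sc by (auto intro!: derivative_eq_intros simp: field_simps)
  have dQc: "((\<lambda>c. sqrt (s\<^sup>2 - c\<^sup>2)) has_real_derivative - (c / Q)) (at c)"
    unfolding Q_def using sc by (auto intro!: derivative_eq_intros simp: field_simps)
  have Q': "sqrt (1 - (c / s)\<^sup>2) = Q / s"
  proof -
    have "1 - (c / s)\<^sup>2 = (s\<^sup>2 - c\<^sup>2) / s\<^sup>2" using pos by (simp add: field_simps)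
    then show ?thesis using pos by (simp add: Q_def real_sqrt_divide)
  qed
  have 1: "((\<lambda>s. arccos (sqrt (1 - k * s\<^sup>2) / C)) has_real_derivative K * s / (A * Q)) (at s)"
  proof -
    have "((\<lambda>s. arccos (sqrt (1 - k * s\<^sup>2) / C)) has_real_derivative
        inverse (- sqrt (1 - (A / C)\<^sup>2)) * (- (K\<^sup>2 * s / A) / C)) (at s)"
      using DERIV_chain2[OF DERIV_arccos DERIV_cdivide[OF dA, of C], unfolded A_def[symmetric]] AC0 AC1
      by simp
    moreover have "inverse (- sqrt (1 - (A / C)\<^sup>2)) * (- (K\<^sup>2 * s / A) / C) = K * s / (A * Q)"
      unfolding rt using pos by (simp add: field_simps power2_eq_square)
    ultimately show ?thesis by simp
  qed
  have 2: "((\<lambda>s. arctan (sqrt (s\<^sup>2 - c\<^sup>2) / (c * sqrt (1 - k * s\<^sup>2)))) has_real_derivative c / (s * Q * A)) (at s)"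
  proof -
    have d: "((\<lambda>s. sqrt (s\<^sup>2 - c\<^sup>2) / (c * sqrt (1 - k * s\<^sup>2))) has_real_derivative
        (s / Q * (c * A) - Q * (c * (- (K\<^sup>2 * s / A)))) / (c * A * (c * A))) (at s)"
      using DERIV_divide[OF dQs DERIV_cmult[OF dA, of c]] pos c unfolding A_def Q_def by simp
    have "(s / Q * (c * A) - Q * (c * (- (K\<^sup>2 * s / A)))) / (c * A * (c * A))
        = s * (A\<^sup>2 + K\<^sup>2 * Q\<^sup>2) / (Q * A * c * A\<^sup>2)"
      using pos c by (simp add: field_simps power2_eq_square)
    also have "A\<^sup>2 + K\<^sup>2 * Q\<^sup>2 = C\<^sup>2" using CA by simp
    finally have e: "(s / Q * (c * A) - Q * (c * (- (K\<^sup>2 * s / A)))) / (c * A * (c * A))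
        = s * C\<^sup>2 / (Q * A * c * A\<^sup>2)" .
    have "((\<lambda>s. arctan (sqrt (s\<^sup>2 - c\<^sup>2) / (c * sqrt (1 - k * s\<^sup>2)))) has_real_derivative
        inverse (1 + (Q / (c * A))\<^sup>2) * (s * C\<^sup>2 / (Q * A * c * A\<^sup>2))) (at s)"
      using DERIV_chain2[OF DERIV_arctan d[unfolded e]] unfolding A_def Q_def by simp
    moreover have "inverse (1 + (Q / (c * A))\<^sup>2) * (s * C\<^sup>2 / (Q * A * c * A\<^sup>2)) = c / (s * Q * A)"
      unfolding at using pos c by (simp add: field_simps power2_eq_square)
    ultimately show ?thesis by simp
  qed
  have "(cap_action k c has_real_derivative K * s / (A * Q) / K - c * (c / (s * Q * A))) (at s)"
    unfolding cap_action_def[abs_def] C_def[symmetric] K_def[symmetric]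
    using DERIV_diff[OF DERIV_cdivide[OF 1] DERIV_cmult[OF 2]] .
  moreover have "K * s / (A * Q) / K - c * (c / (s * Q * A)) = (s\<^sup>2 - c\<^sup>2) / (s * Q * A)"
    using pos by (simp add: field_simps power2_eq_square)
  moreover have "(s\<^sup>2 - c\<^sup>2) / (s * Q * A) = Q / s / A"
    unfolding Q2[symmetric] using pos by (simp add: field_simps power2_eq_square)
  ultimately show "(cap_action k c has_real_derivative sqrt (1 - (c / s)\<^sup>2) / sqrt (1 - k * s\<^sup>2)) (at s)"
    unfolding Q' A_def[symmetric] by simp
  have 3: "((\<lambda>c. arccos (A / sqrt (1 - k * c\<^sup>2))) has_real_derivative - (K * c * A / (C\<^sup>2 * Q))) (at c)"
  proof -
    have d: "((\<lambda>c. A / sqrt (1 - k * c\<^sup>2)) has_real_derivative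
        (0 * C - A * (- (K\<^sup>2 * c / C))) / (C * C)) (at c)"
      using DERIV_divide[OF DERIV_const dC, of A] pos unfolding C_def by simp
    have "((\<lambda>c. arccos (A / sqrt (1 - k * c\<^sup>2))) has_real_derivative
        inverse (- sqrt (1 - (A / C)\<^sup>2)) * ((0 * C - A * (- (K\<^sup>2 * c / C))) / (C * C))) (at c)"
      using DERIV_chain2[OF DERIV_arccos d, unfolded C_def[symmetric]] AC0 AC1 by simp
    moreover have "inverse (- sqrt (1 - (A / C)\<^sup>2)) * ((0 * C - A * (- (K\<^sup>2 * c / C))) / (C * C)) = - (K * c * A / (C\<^sup>2 * Q))"
      unfolding rt using pos by (simp add: field_simps power2_eq_square)
    ultimately show ?thesis by simp
  qed
  have 4: "((\<lambda>c. arctan (sqrt (s\<^sup>2 - c\<^sup>2) / (c * A))) has_real_derivative - (A / (Q * C\<^sup>2))) (at c)"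
  proof -
    have d: "((\<lambda>c. sqrt (s\<^sup>2 - c\<^sup>2) / (c * A)) has_real_derivative
        (- (c / Q) * (c * A) - Q * A) / (c * A * (c * A))) (at c)"
      using DERIV_divide[OF dQc DERIV_cmult_right[OF DERIV_ident, of A]] pos c unfolding Q_def by simp
    have "(- (c / Q) * (c * A) - Q * A) / (c * A * (c * A)) = - ((c\<^sup>2 + Q\<^sup>2) / (Q * c\<^sup>2 * A))"
      using pos c by (simp add: field_simps power2_eq_square)
    also have "c\<^sup>2 + Q\<^sup>2 = s\<^sup>2" unfolding Q2 by simp
    finally have e: "(- (c / Q) * (c * A) - Q * A) / (c * A * (c * A)) = - (s\<^sup>2 / (Q * c\<^sup>2 * A))" .
    have "((\<lambda>c. arctan (sqrt (s\<^sup>2 - c\<^sup>2) / (c * A))) has_real_derivative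
        inverse (1 + (Q / (c * A))\<^sup>2) * (- (s\<^sup>2 / (Q * c\<^sup>2 * A)))) (at c)"
      using DERIV_chain2[OF DERIV_arctan d[unfolded e]] unfolding Q_def by simp
    moreover have "inverse (1 + (Q / (c * A))\<^sup>2) * (- (s\<^sup>2 / (Q * c\<^sup>2 * A))) = - (A / (Q * C\<^sup>2))"
      unfolding at using pos c by (simp add: field_simps power2_eq_square)
    ultimately show ?thesis by simp
  qed
  have "((\<lambda>c. cap_action k c s) has_real_derivative - (K * c * A / (C\<^sup>2 * Q)) / K
       - (1 * arctan (Q / (c * A)) + - (A / (Q * C\<^sup>2)) * c)) (at c)"
    unfolding cap_action_def[abs_def] A_def[symmetric] K_def[symmetric]
    using DERIV_diff[OF DERIV_cdivide[OF 3, of K] DERIV_mult[OF DERIV_ident 4]] unfolding Q_def .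
  moreover have "- (K * c * A / (C\<^sup>2 * Q)) / K - (1 * arctan (Q / (c * A)) + - (A / (Q * C\<^sup>2)) * c)
      = - arctan (Q / (c * A))"
    using pos by (simp add: field_simps)
  ultimately show "((\<lambda>c. cap_action k c s) has_real_derivative
         - arctan (sqrt (s\<^sup>2 - c\<^sup>2) / (c * sqrt (1 - k * s\<^sup>2)))) (at c)"
    unfolding Q_def A_def by simp
qed

text \<open>This covers the end point s = c, the turning radius, where the derivative formulas above
  do not apply.\<close>

lemma continuous_on_cap_action:
  assumes k: "0 < k" and c: "0 < c" and kS: "k * S\<^sup>2 < 1"
  shows "continuous_on {c..S} (cap_action k c)"
proof -
  have p: "k * s\<^sup>2 < 1" "k * c\<^sup>2 \<le> k * s\<^sup>2" "k * c\<^sup>2 < 1" if "s \<in> {c..S}" for s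
  proof -
    have "s\<^sup>2 \<le> S\<^sup>2" "c\<^sup>2 \<le> s\<^sup>2" using that c by (auto intro!: power_mono)
    then have "k * s\<^sup>2 \<le> k * S\<^sup>2" and 2: "k * c\<^sup>2 \<le> k * s\<^sup>2" using k by auto
    then show "k * s\<^sup>2 < 1" "k * c\<^sup>2 \<le> k * s\<^sup>2" "k * c\<^sup>2 < 1" using kS by auto
  qed
  have ac: "- 1 \<le> sqrt (1 - k * s\<^sup>2) / sqrt (1 - k * c\<^sup>2) \<and> sqrt (1 - k * s\<^sup>2) / sqrt (1 - k * c\<^sup>2) \<le> 1"
    if "s \<in> {c..S}" for s
  proof
    have "0 \<le> sqrt (1 - k * s\<^sup>2) / sqrt (1 - k * c\<^sup>2)" using p[OF that] by simp
    then show "- 1 \<le> sqrt (1 - k * s\<^sup>2) / sqrt (1 - k * c\<^sup>2)" by linarith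
    show "sqrt (1 - k * s\<^sup>2) / sqrt (1 - k * c\<^sup>2) \<le> 1" using p[OF that] by simp
  qed
  have nz: "sqrt (1 - k * c\<^sup>2) \<noteq> 0" if "s \<in> {c..S}" for s using p[OF that] by simp
  have nz2: "c * sqrt (1 - k * s\<^sup>2) \<noteq> 0" if "s \<in> {c..S}" for s using p[OF that] c by simp
  show ?thesis unfolding cap_action_def[abs_def]
    using k ac nz nz2 by (intro continuous_intros) auto
qed

lemma cap_action_diagonal [simp]: "k * c\<^sup>2 < 1 \<Longrightarrow> cap_action k c c = 0"
  by (simp add: cap_action_def)

text \<open>In the plane, arccos (c / s) is the angle swept along a straight line from its point
  nearest to the origin. A cone with constant slope b is handled by dividing by b.\<close>

lemma flat_action_derivs:
  fixes c s :: real
  assumes c: "0 < c" "c < s"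
  shows flat_action_deriv_radius: "(flat_action c has_real_derivative sqrt (1 - (c / s)\<^sup>2)) (at s)"
    and flat_action_deriv_const: "((\<lambda>c. flat_action c s) has_real_derivative - arccos (c / s)) (at c)"
proof -
  define Q where "Q = sqrt (s\<^sup>2 - c\<^sup>2)"
  have sc: "c\<^sup>2 < s\<^sup>2" using c by (simp add: power_strict_mono)
  have pos: "0 < Q" "0 < s" using c sc by (auto simp: Q_def)
  have Q2: "Q\<^sup>2 = s\<^sup>2 - c\<^sup>2" using sc by (simp add: Q_def)
  have dQs: "((\<lambda>s. sqrt (s\<^sup>2 - c\<^sup>2)) has_real_derivative s / Q) (at s)"
    unfolding Q_def using sc by (auto intro!: derivative_eq_intros simp: field_simps)
  have dQc: "((\<lambda>c. sqrt (s\<^sup>2 - c\<^sup>2)) has_real_derivative - (c / Q)) (at c)"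
    unfolding Q_def using sc by (auto intro!: derivative_eq_intros simp: field_simps)
  have Q': "sqrt (1 - (c / s)\<^sup>2) = Q / s"
  proof -
    have "1 - (c / s)\<^sup>2 = (s\<^sup>2 - c\<^sup>2) / s\<^sup>2" using pos by (simp add: field_simps)
    then show ?thesis using pos by (simp add: Q_def real_sqrt_divide)
  qed
  have cs: "-1 < c / s" "c / s < 1" using c by (auto intro: less_le_trans[of _ 0])
  have d1: "((\<lambda>s. c / s) has_real_derivative - (c / s\<^sup>2)) (at s)"
    using pos by (auto intro!: derivative_eq_intros simp: power2_eq_square)
  have d2: "((\<lambda>c. c / s) has_real_derivative 1 / s) (at c)"
    using pos by (auto intro!: derivative_eq_intros)
  have "(flat_action c has_real_derivative s / Q - c * (inverse (- (Q / s)) * (- (c / s\<^sup>2)))) (at s)"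
    unfolding flat_action_def[abs_def] Q'[symmetric]
    using DERIV_diff[OF dQs DERIV_cmult[OF DERIV_chain2[OF DERIV_arccos[OF cs] d1]]] .
  moreover have "s / Q - c * (inverse (- (Q / s)) * (- (c / s\<^sup>2))) = (s\<^sup>2 - c\<^sup>2) / (s * Q)"
    using pos by (simp add: field_simps power2_eq_square)
  moreover have "(s\<^sup>2 - c\<^sup>2) / (s * Q) = Q / s"
    unfolding Q2[symmetric] using pos by (simp add: field_simps power2_eq_square)
  ultimately show "(flat_action c has_real_derivative sqrt (1 - (c / s)\<^sup>2)) (at s)"
    unfolding Q' by simp
  have "((\<lambda>c. flat_action c s) has_real_derivative - (c / Q)
      - (1 * arccos (c / s) + inverse (- (Q / s)) * (1 / s) * c)) (at c)"
    unfolding flat_action_def[abs_def] Q'[symmetric]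
    using DERIV_diff[OF dQc DERIV_mult[OF DERIV_ident DERIV_chain2[OF DERIV_arccos[OF cs] d2]]] .
  moreover have "- (c / Q) - (1 * arccos (c / s) + inverse (- (Q / s)) * (1 / s) * c) = - arccos (c / s)"
    using pos by (simp add: field_simps)
  ultimately show "((\<lambda>c. flat_action c s) has_real_derivative - arccos (c / s)) (at c)"
    by simp
qed

text \<open>By the mean value theorem in \<open>c\<close>: the derivative of \<open>W\<close> is
  minus the turning angle of the model, which is at least pi. The curvature \<open>k\<close> is
  chosen such that sqrt (1 - k M^2) = b, so that the slope of the cap at its rim agrees with that of
  the cone.\<close>

lemma model_action_decrease:
  fixes b c c' M N :: real
  assumes b: "0 < b" "b < 1/2" and c: "0 < c" "c < c'" "c' < M"
    and MN: "M \<le> cos (pi * b) * N"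
  defines "k \<equiv> (1 - b\<^sup>2) / M\<^sup>2"
  defines "W \<equiv> \<lambda>c. 2 * cap_action k c M + (flat_action c N - flat_action c M) / b"
  shows "pi * (c' - c) \<le> W c - W c'"
proof -
  have b2: "b\<^sup>2 < 1" "b\<^sup>2 > 0" using b by (simp_all add: power_less_one_iff)
  have k: "k > 0" unfolding k_def using c b2 by simp
  have kM: "k * M\<^sup>2 = 1 - b\<^sup>2" unfolding k_def using c by simp
  have pb: "0 < pi * b" "pi * b < pi / 2" using b by auto
  have cp: "0 < cos (pi * b)" "cos (pi * b) < 1"
    using pb cos_gt_zero_pi[of "pi*b"] cos_monotone_0_pi[of 0 "pi*b"] by auto
  have N: "M < N" 
  proof -
    have "N > 0" using MN c cp by (smt (verit) zero_less_mult_pos)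
    then have "cos (pi * b) * N < N" using cp by simp
    then show ?thesis using MN by simp
  qed
  define W' where "W' = (\<lambda>c. - (2 * arctan (sqrt (M\<^sup>2 - c\<^sup>2) / (c * b)) + (arccos (c / N) - arccos (c / M)) / b))"
  have d: "(W has_real_derivative W' a) (at a)" if a: "0 < a" "a < M" for a
  proof -
    have "((\<lambda>c. cap_action k c M) has_real_derivative - arctan (sqrt (M\<^sup>2 - a\<^sup>2) / (a * sqrt (1 - k * M\<^sup>2)))) (at a)"
      using cap_action_deriv_const[of k a M] k a kM b2 by simp
    then have 1: "((\<lambda>c. cap_action k c M) has_real_derivative - arctan (sqrt (M\<^sup>2 - a\<^sup>2) / (a * b))) (at a)"
      unfolding kM using b by simp
    show ?thesis unfolding W_def W'_def
      by (rule DERIV_cong[OF DERIV_add[OF DERIV_cmult[OF 1]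
            DERIV_cdivide[OF DERIV_diff[OF flat_action_deriv_const flat_action_deriv_const]]]])
        (use a N in \<open>auto simp: diff_divide_distrib\<close>)
  qed
  obtain z where z: "c < z" "z < c'" "W c' - W c = (c' - c) * W' z"
    using MVT2[of c c' W W'] d c by auto
  have "W' z \<le> - pi" using turn_angle_ge_pi[OF b _ _ MN, of z] z c unfolding W'_def by simp
  then have "(c' - c) * W' z \<le> (c' - c) * (- pi)" using c by (intro mult_left_mono) auto
  then show ?thesis using z by (simp add: algebra_simps)
qed

section \<open>Clairaut integrals of a von Mangoldt profile\<close>

text \<open>Along a geodesic with Clairaut constant \<open>c\<close> these are \<open>\<bar>dr/ds\<bar>\<close> and \<open>d\<theta>/dr\<close>; the former is
  extended by zero below the turning radius.\<close>

definition radial_slope :: "(real \<Rightarrow> real) \<Rightarrow> real \<Rightarrow> real \<Rightarrow> real" where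
  "radial_slope m c r = sqrt (max 0 (1 - (c / m r)\<^sup>2))"

definition turn_rate :: "(real \<Rightarrow> real) \<Rightarrow> real \<Rightarrow> real \<Rightarrow> real" where
  "turn_rate m c r = c / ((m r)\<^sup>2 * radial_slope m c r)"

lemma radial_slope_nonneg [simp]: "0 \<le> radial_slope m c r"
  by (simp add: radial_slope_def)

lemma radial_slope_le_1 [simp]: "radial_slope m c r \<le> 1"
  by (simp add: radial_slope_def)

lemma radial_slope_sq: "\<bar>c\<bar> \<le> m r \<Longrightarrow> 0 < m r \<Longrightarrow> (radial_slope m c r)\<^sup>2 = 1 - (c / m r)\<^sup>2"
  by (simp add: radial_slope_def max_def power_divide abs_le_square_iff[symmetric])

lemma radial_slope_eq: "\<bar>c\<bar> \<le> m r \<Longrightarrow> 0 < m r \<Longrightarrow> radial_slope m c r = sqrt (1 - (c / m r)\<^sup>2)"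
  by (simp add: radial_slope_def max_def power_divide abs_le_square_iff[symmetric])

lemma radial_slope_pos: "0 \<le> c \<Longrightarrow> c < m r \<Longrightarrow> 0 < radial_slope m c r"
  by (simp add: radial_slope_def power_divide power_strict_mono)

lemma radial_slope_eq_0: "0 < m r \<Longrightarrow> m r \<le> c \<Longrightarrow> radial_slope m c r = 0"
  by (simp add: radial_slope_def max_def power_divide power_mono antisym)

lemma radial_slope_antimono:
  assumes "0 \<le> c" "c \<le> c'" "0 < m r"
  shows "radial_slope m c' r \<le> radial_slope m c r"
proof -
  have "(c / m r)\<^sup>2 \<le> (c' / m r)\<^sup>2" using assms by (intro power_mono divide_right_mono) auto
  then show ?thesis unfolding radial_slope_def by simp
qed

locale smooth_profile =
  fixes m :: "real \<Rightarrow> real"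
  assumes profile: "profile m"
begin

lemma zero [simp]: "m 0 = 0" and deriv_zero [simp]: "deriv m 0 = 1"
  and pos: "r > 0 \<Longrightarrow> m r > 0"
  using profile by (auto simp: profile_def)

lemma has_deriv: "(m has_real_derivative deriv m r) (at r)"
proof -
  have "((deriv ^^ 0) m) differentiable (at r)"
    using profile unfolding profile_def smooth_fun_def by blast
  then show ?thesis by (simp add: DERIV_deriv_iff_real_differentiable)
qed

lemma deriv_has_deriv: "(deriv m has_real_derivative deriv (deriv m) r) (at r)"
proof -
  have "((deriv ^^ 1) m) differentiable (at r)"
    using profile unfolding profile_def smooth_fun_def by blast
  then show ?thesis by (simp add: DERIV_deriv_iff_real_differentiable)
qed

lemma continuous: "continuous_on S m"
  using has_deriv by (meson DERIV_isCont continuous_at_imp_continuous_on)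

lemma deriv_continuous: "continuous_on S (deriv m)"
  using deriv_has_deriv by (meson DERIV_isCont continuous_at_imp_continuous_on)

lemma strict_mono:
  assumes "\<forall>t\<in>{0..Y}. deriv m t > 0" "0 \<le> r" "r < s" "s \<le> Y"
  shows "m r < m s"
  using DERIV_pos_imp_increasing[of r s m] assms has_deriv by (meson atLeastAtMost_iff order_trans)

lemma mono:
  assumes "\<forall>t\<in>{0..Y}. deriv m t > 0" "0 \<le> r" "r \<le> s" "s \<le> Y"
  shows "m r \<le> m s"
  using strict_mono[OF assms(1,2) _ assms(4)] assms(3) by (cases "r = s") auto

lemma radial_slope_continuous: "S \<subseteq> {0<..} \<Longrightarrow> continuous_on S (radial_slope m c)"
proof -
  assume "S \<subseteq> {0<..}"
  then have "m r \<noteq> 0" if "r \<in> S" for r using pos[of r] that by auto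
  then show ?thesis unfolding radial_slope_def[abs_def] by (intro continuous_intros continuous) auto
qed

lemma radial_slope_integrable: "0 < a \<Longrightarrow> radial_slope m c integrable_on {a..b}"
  by (intro integrable_continuous_interval radial_slope_continuous) auto

text \<open>Von Mangoldt means that the square of \<^term>\<open>deriv m\<close> is a convex function of the square of
  \<^term>\<open>m\<close>, so that it lies below its chords.\<close>

lemma deriv_sq_below_chord:
  assumes vm: "von_mangoldt m" and R: "0 < R" and pos': "\<forall>t\<in>{0..R}. deriv m t > 0" and r: "0 \<le> r" "r \<le> R"
  shows "(deriv m r)\<^sup>2 \<le> 1 - (1 - (deriv m R)\<^sup>2) / (m R)\<^sup>2 * (m r)\<^sup>2"
proof (rule ccontr)
  define k where "k = (1 - (deriv m R)\<^sup>2) / (m R)\<^sup>2"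
  define f where "f = (\<lambda>r. (deriv m r)\<^sup>2 - 1 + k * (m r)\<^sup>2)"
  have mR: "m R > 0" using pos R by simp
  have f0: "f 0 = 0" by (simp add: f_def)
  have fR: "f R = 0" using mR by (simp add: f_def k_def)
  assume "\<not> ?thesis"
  then have fr: "f r > 0" by (simp add: f_def k_def)
  have r': "0 < r" "r < R" using fr f0 fR r by (auto simp: less_le)
  have df: "(f has_real_derivative 2 * deriv m t * m t * (k - curv m t)) (at t)" if "t > 0" for t
  proof -
    have "(f has_real_derivative 2 * deriv m t * deriv (deriv m) t + k * (2 * m t * deriv m t)) (at t)"
      unfolding f_def using has_deriv deriv_has_deriv by (auto intro!: derivative_eq_intros)
    moreover have "deriv (deriv m) t = - (curv m t * m t)" using pos[OF that] by (simp add: curv_def)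
    ultimately show ?thesis by (simp add: algebra_simps)
  qed
  have cf: "continuous_on {0..r} f"
    unfolding f_def by (intro continuous_intros continuous deriv_continuous)
  \<comment> \<open>Since \<open>f\<close> rises from 0 to a positive value, the curvature is below
    \<open>k\<close> at some \<open>u\<close> before \<open>r\<close>. Monotonicity of the curvature
    then makes \<open>f\<close> increase after \<open>r\<close> as well, against f R = 0. The
    derivative formula is available for positive radii only, hence the mean value theorem for the
    open interval.\<close>
  obtain l u where u: "0 < u" "u < r" "(f has_real_derivative l) (at u)" "f r - f 0 = (r - 0) * l"
    using MVT[OF r'(1) cf] df real_differentiable_def by (smt (verit))
  have "l = 2 * deriv m u * m u * (k - curv m u)" using DERIV_unique[OF u(3) df] u by simp
  moreover have "l > 0" using u(4) fr f0 r' by (simp add: zero_less_mult_iff)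
  moreover have "2 * deriv m u * m u > 0" using pos' pos[of u] u r' by simp
  ultimately have ku: "curv m u < k" by (smt (verit) mult_nonneg_nonpos)
  obtain w where w: "r < w" "w < R" "f R - f r = (R - r) * (2 * deriv m w * m w * (k - curv m w))"
    using MVT2[OF r'(2), of f "\<lambda>t. 2 * deriv m t * m t * (k - curv m t)"] df r' by auto
  have "curv m w \<le> curv m u" using vm u w unfolding von_mangoldt_def by auto
  then have "2 * deriv m w * m w * (k - curv m w) > 0" using ku pos' pos[of w] w r' by simp
  then have "f R - f r > 0" using w r' by simp
  then show False using fR fr by simp
qed

text \<open>Substitution s = m t. The differentiation is done in the open interval only, because
  \<open>r\<close> is the turning radius.\<close>

lemma cap_action_integral:
  assumes Y: "\<forall>t\<in>{0..a}. deriv m t > 0" and r: "0 < r" "r < a" and k: "0 < k" "k * (m a)\<^sup>2 < 1"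
  shows "((\<lambda>t. radial_slope m (m r) t * deriv m t / sqrt (1 - k * (m t)\<^sup>2)) has_integral
           cap_action k (m r) (m a)) {r..a}"
proof -
  have mr: "0 < m r" using pos r by simp
  have ka: "k * (m t)\<^sup>2 < 1" if "r \<le> t" "t \<le> a" for t
  proof -
    have "m t \<le> m a" "0 < m t" using mono[OF Y] pos that r by auto
    then have "k * (m t)\<^sup>2 \<le> k * (m a)\<^sup>2" using k by (intro mult_left_mono power_mono) auto
    then show ?thesis using k by linarith
  qed
  have "((\<lambda>t. radial_slope m (m r) t * deriv m t / sqrt (1 - k * (m t)\<^sup>2)) has_integral
           cap_action k (m r) (m a) - cap_action k (m r) (m r)) {r..a}"
  proof (rule fundamental_theorem_of_calculus_interior)
    have "m ` {r..a} \<subseteq> {m r..m a}" using mono[OF Y] r by auto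
    then show "continuous_on {r..a} (\<lambda>t. cap_action k (m r) (m t))"
      using continuous_on_compose2[OF continuous_on_cap_action[OF k(1) mr k(2)] continuous] by blast
    fix t assume t: "t \<in> {r<..<a}"
    have lt: "m r < m t" using strict_mono[OF Y] t r by auto
    have "radial_slope m (m r) t = sqrt (1 - (m r / m t)\<^sup>2)"
      using lt mr by (intro radial_slope_eq) auto
    then show "((\<lambda>t. cap_action k (m r) (m t)) has_vector_derivative
        radial_slope m (m r) t * deriv m t / sqrt (1 - k * (m t)\<^sup>2)) (at t)"
      using DERIV_chain2[OF cap_action_deriv_radius[OF k(1) mr lt ka] has_deriv] t
      by (simp add: has_real_derivative_iff_has_vector_derivative)
  qed (use r in auto)
  then show ?thesis using ka[of r] r by simp
qed

lemma flat_action_integral: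
  assumes Y: "\<forall>t\<in>{0..y}. deriv m t > 0" and r: "0 < c" "c < m a" "0 < a" "a \<le> y"
  shows "((\<lambda>t. radial_slope m c t * deriv m t) has_integral flat_action c (m y) - flat_action c (m a)) {a..y}"
proof (rule fundamental_theorem_of_calculus)
  fix t assume t: "t \<in> {a..y}"
  have lt: "c < m t" using mono[OF Y, of a t] t r by auto
  have "radial_slope m c t = sqrt (1 - (c / m t)\<^sup>2)"
    using lt r by (intro radial_slope_eq) auto
  then have "((\<lambda>t. flat_action c (m t)) has_vector_derivative radial_slope m c t * deriv m t) (at t)"
    using DERIV_chain2[OF flat_action_deriv_radius[OF r(1) lt] has_deriv]
    by (simp add: has_real_derivative_iff_has_vector_derivative)
  then show "((\<lambda>t. flat_action c (m t)) has_vector_derivative radial_slope m c t * deriv m t) (at t within {a..y})"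
    by (rule has_vector_derivative_at_within)
qed (use r in auto)

text \<open>The difference \<open>D\<close> of the radial slopes for two Clairaut constants is
  nonnegative. Multiplying it by the quotient of m' and the slope of the model, which is at most 1,
  only makes it smaller, and after the substitution s = m t it integrates to the difference of the
  model actions. So the estimate for the model carries over.\<close>

lemma action_decrease:
  assumes vm: "von_mangoldt m" and Y: "\<forall>t\<in>{0..Y}. deriv m t > 0"
    and b: "0 < b" "b < 1/2" "\<forall>t\<in>{a..y}. deriv m t \<le> b"
    and ay: "0 < a" "a \<le> y" "y \<le> Y" "m a \<le> cos (pi * b) * m y"
    and r: "0 < r" "r < r'" "r' < a"
  defines "W \<equiv> \<lambda>r. 2 * integral {r..a} (radial_slope m (m r)) + integral {a..Y} (radial_slope m (m r))"
  shows "pi * (m r' - m r) \<le> W r - W r'"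
proof -
  define k where "k = (1 - b\<^sup>2) / (m a)\<^sup>2"
  have b2: "b\<^sup>2 < 1" "b\<^sup>2 > 0" using b by (simp_all add: power_less_one_iff)
  have mp: "0 < m r" "m r < m r'" "m r' < m a" using pos r strict_mono[OF Y] ay by auto
  have k: "0 < k" "k * (m a)\<^sup>2 = 1 - b\<^sup>2" unfolding k_def using b2 mp by auto
  then have ka: "k * (m a)\<^sup>2 < 1" using b2 by simp
  have Ya: "\<forall>t\<in>{0..a}. deriv m t > 0" and Yy: "\<forall>t\<in>{0..y}. deriv m t > 0" using Y ay by auto
  define D where "D = (\<lambda>t. radial_slope m (m r) t - radial_slope m (m r') t)"
  have D0: "0 \<le> D t" if "t > 0" for t
    unfolding D_def using radial_slope_antimono[of "m r" "m r'" m t] mp pos[OF that] by simp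
  have Dc: "continuous_on S D" if "S \<subseteq> {0<..}" for S
    unfolding D_def by (intro continuous_intros radial_slope_continuous that)
  have p: "deriv m t \<le> sqrt (1 - k * (m t)\<^sup>2)" "0 < sqrt (1 - k * (m t)\<^sup>2)" if t: "t \<in> {r..a}" for t
  proof -
    have mt: "0 < m t" "m t \<le> m a" using pos mono[OF Ya] t r by auto
    \<comment> \<open>Replacing the slope at \<open>a\<close> by the possibly larger
      \<open>b\<close> raises the chord, so the cap with rim slope \<open>b\<close> still lies above
      the profile.\<close>
    have "(deriv m a)\<^sup>2 \<le> b\<^sup>2" using b Ya ay by (intro power_mono) (auto simp: less_imp_le)
    then have "(1 - b\<^sup>2) / (m a)\<^sup>2 * (m t)\<^sup>2 \<le> (1 - (deriv m a)\<^sup>2) / (m a)\<^sup>2 * (m t)\<^sup>2"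
      by (intro mult_right_mono divide_right_mono) auto
    then have "(deriv m t)\<^sup>2 \<le> 1 - k * (m t)\<^sup>2"
      using deriv_sq_below_chord[OF vm ay(1) Ya, of t] t r unfolding k_def by simp
    then show "deriv m t \<le> sqrt (1 - k * (m t)\<^sup>2)" by (rule real_le_rsqrt)
    have "k * (m t)\<^sup>2 \<le> k * (m a)\<^sup>2" using k mt by (intro mult_left_mono power_mono) auto
    then show "0 < sqrt (1 - k * (m t)\<^sup>2)" using ka by simp
  qed
  let ?g = "\<lambda>c t. radial_slope m c t * deriv m t / sqrt (1 - k * (m t)\<^sup>2)"
  have i1: "(?g (m r) has_integral cap_action k (m r) (m a)) {r..a}"
    using cap_action_integral[OF Ya _ _ k(1) ka] r by auto
  \<comment> \<open>Below its turning radius the slope is zero by definition, so the action for the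
    larger constant may also be integrated from \<open>r\<close>.\<close>
  have zero': "radial_slope m (m r') t = 0" if "t \<in> {r..r'}" for t
    using that r ay mono[OF Y, of t r'] pos[of t] by (intro radial_slope_eq_0) auto
  have "(?g (m r') has_integral 0) {r..r'}"
    by (rule has_integral_eq[OF _ has_integral_0]) (simp add: zero')
  moreover have "(?g (m r') has_integral cap_action k (m r') (m a)) {r'..a}"
    using cap_action_integral[OF Ya _ _ k(1) ka] r by auto
  ultimately have i2: "(?g (m r') has_integral 0 + cap_action k (m r') (m a)) {r..a}"
    using r by (intro has_integral_combine[of r r' a]) auto
  have i3: "((\<lambda>t. D t * deriv m t / sqrt (1 - k * (m t)\<^sup>2)) has_integral
      cap_action k (m r) (m a) - cap_action k (m r') (m a)) {r..a}"
    using has_integral_diff[OF i1 i2] by (simp add: D_def algebra_simps diff_divide_distrib)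
  have "cap_action k (m r) (m a) - cap_action k (m r') (m a) \<le> integral {r..a} D"
  proof (rule has_integral_le[OF i3 integrable_integral])
    show "D integrable_on {r..a}" using r by (intro integrable_continuous_interval Dc) auto
    fix t assume t: "t \<in> {r..a}"
    have "D t * (deriv m t / sqrt (1 - k * (m t)\<^sup>2)) \<le> D t * 1"
      using p[OF t] D0[of t] t r by (intro mult_left_mono) auto
    then show "D t * deriv m t / sqrt (1 - k * (m t)\<^sup>2) \<le> D t" by simp
  qed
  also have "integral {r..a} D = integral {r..a} (radial_slope m (m r)) - integral {r..a} (radial_slope m (m r'))"
    unfolding D_def using r by (intro integral_diff radial_slope_integrable) auto
  also have "integral {r..a} (radial_slope m (m r')) = integral {r..r'} (radial_slope m (m r')) + integral {r'..a} (radial_slope m (m r'))"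
    using r by (intro Henstock_Kurzweil_Integration.integral_combine[symmetric] radial_slope_integrable) auto
  also have "integral {r..r'} (radial_slope m (m r')) = 0"
    using integral_cong[of "{r..r'}" "radial_slope m (m r')" "\<lambda>_. 0"] zero' by simp
  finally have inner: "cap_action k (m r) (m a) - cap_action k (m r') (m a)
      \<le> integral {r..a} (radial_slope m (m r)) - integral {r'..a} (radial_slope m (m r'))" by simp
  have i4: "((\<lambda>t. D t * deriv m t / b) has_integral
     ((flat_action (m r) (m y) - flat_action (m r) (m a)) - (flat_action (m r') (m y) - flat_action (m r') (m a))) / b) {a..y}"
    using has_integral_divide[OF has_integral_diff[OF flat_action_integral[OF Yy, of "m r" a] flat_action_integral[OF Yy, of "m r'" a]], of b]
      mp ay by (simp add: D_def algebra_simps)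
  have "((flat_action (m r) (m y) - flat_action (m r) (m a)) - (flat_action (m r') (m y) - flat_action (m r') (m a))) / b
     \<le> integral {a..y} D"
  proof (rule has_integral_le[OF i4 integrable_integral])
    show "D integrable_on {a..y}" using ay by (intro integrable_continuous_interval Dc) auto
    fix t assume t: "t \<in> {a..y}"
    have "D t * (deriv m t / b) \<le> D t * 1"
      using b D0[of t] t ay by (intro mult_left_mono) auto
    then show "D t * deriv m t / b \<le> D t" by simp
  qed
  also have "\<dots> \<le> integral {a..Y} D"
    using ay by (intro integral_subset_le integrable_continuous_interval Dc) (auto intro: D0)
  also have "\<dots> = integral {a..Y} (radial_slope m (m r)) - integral {a..Y} (radial_slope m (m r'))"
    unfolding D_def using ay by (intro integral_diff radial_slope_integrable) auto
  finally have outer: "((flat_action (m r) (m y) - flat_action (m r) (m a)) - (flat_action (m r') (m y) - flat_action (m r') (m a))) / b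
     \<le> integral {a..Y} (radial_slope m (m r)) - integral {a..Y} (radial_slope m (m r'))" .
  show ?thesis
    using model_action_decrease[OF b(1,2) mp(1,2,3) ay(4)] inner outer
    unfolding W_def k_def[symmetric] by (simp add: diff_divide_distrib)
qed

section \<open>The turning angle between two radii as a function of the Clairaut constant\<close>

lemma turn_rate_pos: "0 < c \<Longrightarrow> c < m r \<Longrightarrow> 0 < turn_rate m c r"
  by (simp add: turn_rate_def radial_slope_pos)

text \<open>Joint continuity makes the turning angle depend continuously on the Clairaut constant.
  Keeping \<open>C\<close> below \<open>m\<close> on the whole interval keeps the denominator
  nonzero.\<close>

lemma turn_rate_continuous:
  assumes "0 < a" "\<forall>t\<in>{a..Y}. C < m t"
  shows "continuous_on ({0..C} \<times> {a..Y}) (\<lambda>(c, t). turn_rate m c t)"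
proof -
  have [simp]: "m t \<noteq> 0" "m t > 0" if "a \<le> t" for t using pos[of t] assms that by auto
  have s: "radial_slope m c t \<noteq> 0" if "c \<in> {0..C}" "t \<in> {a..Y}" for c t
  proof -
    have "c < m t" using assms(2) that by (meson atLeastAtMost_iff le_less_trans)
    then show ?thesis using radial_slope_pos[of c m t] that by simp
  qed
  have "continuous_on ({0..C} \<times> {a..Y}) (\<lambda>z. m (snd z))"
    by (rule continuous_on_compose2[OF continuous[of UNIV]]) (auto intro!: continuous_intros)
  then show ?thesis using s unfolding turn_rate_def radial_slope_def split_beta
    by (intro continuous_intros) auto
qed

text \<open>As the constant tends to m a, the cone estimate on [a, y] tends to arccos (m a / m y) /
  b, which is at least pi. The radii between \<open>y\<close> and \<open>Y\<close> add a positive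
  amount, so pi is reached already for some constant strictly below m a.\<close>

lemma turning_exceeds_pi:
  assumes Y: "\<forall>t\<in>{0..Y}. deriv m t > 0"
    and b: "0 < b" "b < 1/2" "\<forall>t\<in>{a..y}. deriv m t \<le> b"
    and ay: "0 < a" "a < y" "y < Y" "m a \<le> cos (pi * b) * m y"
  obtains C where "0 < C" "C < m a" "pi \<le> integral {a..Y} (turn_rate m C)"
proof -
  have mp: "0 < m a" "m a < m y" "m y < m Y" using pos strict_mono[OF Y] ay by auto
  \<comment> \<open>The first summand is the turning angle of the cone up to \<open>y\<close>. The
    second is a lower bound for the turning from \<open>y\<close> to \<open>Y\<close>.\<close>
  define f where "f = (\<lambda>c. (arccos (c / m y) - arccos (c / m a)) / b + c * (Y - y) / (m Y)\<^sup>2)"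
  have "continuous_on {0..m a} f" unfolding f_def using mp b
    by (intro continuous_intros) (auto intro: order_trans[of _ 0])
  then have lim: "(f \<longlongrightarrow> f (m a)) (at (m a) within {0..m a})"
    using mp by (auto simp: continuous_on_def)
  have "pi * b \<le> arccos (m a / m y)"
  proof -
    have "arccos (cos (pi * b)) \<le> arccos (m a / m y)" using mp ay
      by (intro arccos_le_arccos) (auto simp: field_simps intro: order_trans[of _ 0])
    moreover have "arccos (cos (pi * b)) = pi * b" using b by (intro arccos_cos) auto
    ultimately show ?thesis by simp
  qed
  then have "pi \<le> arccos (m a / m y) / b" using b by (simp add: field_simps)
  moreover have "0 < m a * (Y - y) / (m Y)\<^sup>2" using mp ay by simp
  ultimately have "pi < f (m a)" unfolding f_def using mp by simp
  then have "\<forall>\<^sub>F c in at (m a) within {0..m a}. pi < f c" by (rule order_tendstoD(1)[OF lim])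
  then obtain d where d: "d > 0" "\<And>c. c \<in> {0..m a} \<Longrightarrow> c \<noteq> m a \<Longrightarrow> dist c (m a) < d \<Longrightarrow> pi < f c"
    unfolding eventually_at by blast
  define C where "C = max (m a / 2) (m a - d / 2)"
  have C: "0 < C" "C < m a" using mp d by (auto simp: C_def)
  have "dist C (m a) < d" using mp d by (auto simp: C_def dist_real_def)
  then have fC: "pi < f C" using d C by auto
  have lt: "C < m t" if "t \<in> {a..Y}" for t using mono[OF Y, of a t] that C ay by auto
  have cont: "continuous_on {a..Y} (turn_rate m C)"
  proof -
    have "continuous_on {a..Y} ((\<lambda>(c, t). turn_rate m c t) \<circ> (\<lambda>t. (C, t)))"
      using C lt ay by (intro continuous_on_compose continuous_on_subset[OF turn_rate_continuous[of a Y C]]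
          continuous_intros) auto
    then show ?thesis by (simp add: o_def)
  qed
  have int: "turn_rate m C integrable_on {s..t}" if "{s..t} \<subseteq> {a..Y}" for s t
    using continuous_on_subset[OF cont that] by (rule integrable_continuous_interval)
  have key: "turn_rate m C t = C / (m t * sqrt ((m t)\<^sup>2 - C\<^sup>2))" if "t \<in> {a..Y}" for t
  proof -
    have "radial_slope m C t = sqrt (1 - (C / m t)\<^sup>2)" using lt[OF that] C by (intro radial_slope_eq) auto
    also have "1 - (C / m t)\<^sup>2 = ((m t)\<^sup>2 - C\<^sup>2) / (m t)\<^sup>2" using lt[OF that] C by (simp add: field_simps)
    finally show ?thesis unfolding turn_rate_def using lt[OF that] C
      by (simp add: real_sqrt_divide power2_eq_square)
  qed
  have i1: "((\<lambda>t. turn_rate m C t * deriv m t / b) has_integral (arccos (C / m y) - arccos (C / m a)) / b) {a..y}"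
  proof (intro has_integral_divide fundamental_theorem_of_calculus)
    fix t assume t: "t \<in> {a..y}"
    have l: "C < m t" using lt t ay by auto
    have dC: "((\<lambda>t. C / m t) has_real_derivative - (C * deriv m t / (m t)\<^sup>2)) (at t)"
      using DERIV_divide[OF DERIV_const has_deriv, of t C] l C by (simp add: power2_eq_square)
    have "((\<lambda>t. arccos (C / m t)) has_real_derivative
       inverse (- sqrt (1 - (C / m t)\<^sup>2)) * (- (C * deriv m t / (m t)\<^sup>2))) (at t)"
      using l C by (intro DERIV_chain2[OF DERIV_arccos dC]) (auto intro: less_le_trans[of _ 0])
    moreover have "sqrt (1 - (C / m t)\<^sup>2) = radial_slope m C t" using l C by (intro radial_slope_eq[symmetric]) auto
    ultimately have "((\<lambda>t. arccos (C / m t)) has_real_derivative turn_rate m C t * deriv m t) (at t)"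
      by (simp add: turn_rate_def field_simps)
    then show "((\<lambda>t. arccos (C / m t)) has_vector_derivative turn_rate m C t * deriv m t) (at t within {a..y})"
      by (simp add: has_real_derivative_iff_has_vector_derivative has_vector_derivative_at_within)
  qed (use ay in auto)
  have "(arccos (C / m y) - arccos (C / m a)) / b \<le> integral {a..y} (turn_rate m C)"
  proof (rule has_integral_le[OF i1 integrable_integral])
    show "turn_rate m C integrable_on {a..y}" using ay by (intro int) auto
    fix t assume t: "t \<in> {a..y}"
    have "turn_rate m C t > 0" using turn_rate_pos C lt t ay by auto
    then have "turn_rate m C t * (deriv m t / b) \<le> turn_rate m C t * 1"
      using b t by (intro mult_left_mono) auto
    then show "turn_rate m C t * deriv m t / b \<le> turn_rate m C t" by simp
  qed
  moreover have "C * (Y - y) / (m Y)\<^sup>2 \<le> integral {y..Y} (turn_rate m C)"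
  proof -
    have "((\<lambda>_. C / (m Y)\<^sup>2) has_integral (C * (Y - y) / (m Y)\<^sup>2)) {y..Y}"
      using has_integral_const_real[of "C / (m Y)\<^sup>2" y Y] ay by (simp add: mult.commute)
    moreover have "C / (m Y)\<^sup>2 \<le> turn_rate m C t" if t: "t \<in> {y..Y}" for t
    proof -
      have l: "C < m t" "m t \<le> m Y" using lt t ay mono[OF Y, of t Y] by auto
      have "m t \<le> m Y" "0 \<le> m t" using l C by auto
      then have "(m t)\<^sup>2 * radial_slope m C t \<le> (m Y)\<^sup>2 * 1"
        by (intro mult_mono power_mono) auto
      moreover have "(m t)\<^sup>2 * radial_slope m C t > 0"
        using l C radial_slope_pos[of C m t] by simp
      ultimately show ?thesis unfolding turn_rate_def using C mp by (intro divide_left_mono) auto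
    qed
    ultimately show ?thesis
      using has_integral_le[OF _ integrable_integral[OF int[of y Y]]] ay by force
  qed
  moreover have "integral {a..y} (turn_rate m C) + integral {y..Y} (turn_rate m C) = integral {a..Y} (turn_rate m C)"
    using ay by (intro Henstock_Kurzweil_Integration.integral_combine int) auto
  ultimately have "pi \<le> integral {a..Y} (turn_rate m C)" using fC unfolding f_def by linarith
  then show ?thesis using that C by blast
qed

text \<open>The geodesic with constant 0 does not turn, so the intermediate value theorem applies on
  [0, C].\<close>

lemma turning_angle_attained:
  assumes "0 < a" "0 \<le> C" "\<forall>t\<in>{a..Y}. C < m t"
    and th: "0 \<le> th" "th \<le> integral {a..Y} (turn_rate m C)"
  obtains c where "0 \<le> c" "c \<le> C" "integral {a..Y} (turn_rate m c) = th"
proof -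
  have "continuous_on {0..C} (\<lambda>c. integral (cbox a Y) (turn_rate m c))"
    by (rule integral_continuous_on_param) (use turn_rate_continuous[OF assms(1,3)] in simp)
  then have 1: "continuous_on {0..C} (\<lambda>c. integral {a..Y} (turn_rate m c))" by (simp add: cbox_interval)
  have "turn_rate m 0 = (\<lambda>_. 0)" by (auto simp: turn_rate_def)
  then have 2: "integral {a..Y} (turn_rate m 0) \<le> th" using th by simp
  show ?thesis using IVT'[of "\<lambda>c. integral {a..Y} (turn_rate m c)", OF 2 th(2) assms(2) 1] that by blast
qed

end

section \<open>Lengths of curves and calibrations\<close>

definition speed :: "(real \<Rightarrow> real) \<Rightarrow> complex \<Rightarrow> complex \<Rightarrow> real" where
  "speed m p v = sqrt (gmet m p v v)"

text \<open>The velocity is carried as explicit data and derivatives are taken within the interval,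
  so that a curve can be cut into pieces of the same kind.\<close>

definition c1_curve :: "(real \<Rightarrow> complex) \<Rightarrow> (real \<Rightarrow> complex) \<Rightarrow> real \<Rightarrow> real \<Rightarrow> bool" where
  "c1_curve g v a b \<longleftrightarrow>
     (\<forall>t\<in>{a..b}. (g has_vector_derivative v t) (at t within {a..b})) \<and> continuous_on {a..b} v"

definition arc_length :: "(real \<Rightarrow> real) \<Rightarrow> (real \<Rightarrow> complex) \<Rightarrow> (real \<Rightarrow> complex) \<Rightarrow> real \<Rightarrow> real \<Rightarrow> real" where
  "arc_length m g v a b = integral {a..b} (\<lambda>t. speed m (g t) (v t))"

lemma c1_curveD:
  assumes "c1_curve g v a b"
  shows "t \<in> {a..b} \<Longrightarrow> (g has_vector_derivative v t) (at t within {a..b})"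
    and "continuous_on {a..b} v" and "continuous_on {a..b} g"
  using assms unfolding c1_curve_def
  by (auto intro: has_vector_derivative_continuous simp: continuous_on_eq_continuous_within)

lemma c1_curve_subset:
  assumes "c1_curve g v a b" "{c..d} \<subseteq> {a..b}"
  shows "c1_curve g v c d"
  using assms unfolding c1_curve_def
  by (meson continuous_on_subset has_vector_derivative_within_subset subsetD)

text \<open>The quotient \<open>v / p\<close> is the logarithmic derivative of a curve through
  \<open>p\<close> with velocity \<open>v\<close>: its real part is r' / r and its imaginary part is
  the angular velocity.\<close>

lemma gmet_polar:
  assumes "p \<noteq> 0"
  shows "gmet m p v v = (norm p * Re (v / p))\<^sup>2 + (m (norm p) * Im (v / p))\<^sup>2"
proof -
  define r where "r = norm p"
  have r: "r > 0" using assms by (simp add: r_def)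
  define w where "w = v / p"
  have v: "v = w * p" using assms by (simp add: w_def)
  have rr: "Re p * Re p + Im p * Im p = r * r"
    by (metis cmod_power2 power2_eq_square r_def)
  have "inner v (p / of_real r) = Re w * (Re p * Re p + Im p * Im p) / r"
    using r unfolding v inner_complex_def by (simp add: field_simps)
  then have 1: "inner v (p / of_real r) = r * Re w" unfolding rr using r by simp
  have "inner v (\<i> * (p / of_real r)) = Im w * (Re p * Re p + Im p * Im p) / r"
    using r unfolding v inner_complex_def by (simp add: field_simps)
  then have 2: "inner v (\<i> * (p / of_real r)) = r * Im w" unfolding rr using r by simp
  show ?thesis using assms r unfolding gmet_def Let_def r_def[symmetric] 1 2 w_def[symmetric]
    by (simp add: power2_eq_square)
qed

lemma gmet_nonneg: "0 \<le> gmet m p v v"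
  by (cases "p = 0") (simp_all add: gmet_polar, simp add: gmet_def)

lemma speed_nonneg [simp]: "0 \<le> speed m p v"
  by (simp add: speed_def gmet_nonneg)

lemma speed_scaleR: "speed m p (c *\<^sub>R v) = \<bar>c\<bar> * speed m p v"
proof -
  have "gmet m p (c *\<^sub>R v) (c *\<^sub>R v) = c\<^sup>2 * gmet m p v v"
    by (simp add: gmet_def Let_def power2_eq_square algebra_simps)
  then show ?thesis by (simp add: speed_def real_sqrt_mult)
qed

lemma inner_eq_Re_divide:
  fixes v p :: complex
  assumes "p \<noteq> 0"
  shows "inner v p = Re (v / p) * (norm p)\<^sup>2"
proof -
  have "inner v p = Re (v * cnj p)" by (simp add: inner_complex_def)
  also have "v * cnj p = (v / p) * (p * cnj p)" using assms by simp
  also have "p * cnj p = of_real ((norm p)\<^sup>2)" by (rule complex_norm_square[symmetric])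
  finally show ?thesis
    by (simp only: times_complex.sel Re_complex_of_real Im_complex_of_real mult_zero_right diff_0_right)
qed

text \<open>The inner product is r r', and the radial part of the velocity is at most the speed. At
  the pole both sides vanish.\<close>

lemma inner_le_speed: "\<bar>inner v p\<bar> \<le> norm p * speed m p v"
proof (cases "p = 0")
  case False
  define w where "w = v / p"
  have "inner v p = Re w * (norm p)\<^sup>2"
    unfolding w_def by (rule inner_eq_Re_divide[OF False])
  then have "\<bar>inner v p\<bar> = norm p * \<bar>norm p * Re w\<bar>" by (simp add: abs_mult power2_eq_square)
  moreover have "\<bar>norm p * Re w\<bar> \<le> speed m p v"
    unfolding speed_def gmet_polar[OF False] w_def by (intro real_le_rsqrt) simp
  ultimately show ?thesis by (simp add: mult_left_mono)
qed simp

lemma norm_has_deriv: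
  fixes g :: "real \<Rightarrow> complex"
  assumes "(g has_vector_derivative v) (at t within S)" "g t \<noteq> 0"
  shows "((\<lambda>t. norm (g t)) has_real_derivative norm (g t) * Re (v / g t)) (at t within S)"
proof -
  have "((\<lambda>t. norm (g t)) has_derivative (\<lambda>h. inner (h *\<^sub>R v) (sgn (g t)))) (at t within S)"
    using has_derivative_compose[OF assms(1)[unfolded has_vector_derivative_def] has_derivative_norm[OF assms(2)]] .
  moreover have "inner v (sgn (g t)) = norm (g t) * Re (v / g t)"
    using inner_eq_Re_divide[OF assms(2), of v] assms(2)
    by (simp add: sgn_div_norm power2_eq_square inner_commute field_simps)
  ultimately show ?thesis
    by (simp add: has_field_derivative_def mult_commute_abs)
qed

context smooth_profile
begin

text \<open>Only the pole is delicate, since the unit radial vector jumps there. The metric is the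
  Euclidean one plus a bounded angular term times a factor \<open>X\<close> of the radius, and
  \<open>X\<close> tends to 0 at the pole because m r / r tends to m' 0 = 1.\<close>

lemma gmet_continuous:
  assumes "continuous_on S f" "continuous_on S g"
  shows "continuous_on S (\<lambda>t. gmet m (f t) (g t) (g t))"
proof -
  define X where "X = (\<lambda>r. if r = 0 then 0 else (m r / r)\<^sup>2 - 1)"
  have gm: "gmet m p v v = (norm v)\<^sup>2 + X (norm p) * (inner v (\<i> * sgn p))\<^sup>2" for p v
  proof (cases "p = 0")
    case False
    define u where "u = sgn p"
    have "norm u = 1" using False by (simp add: u_def norm_sgn)
    then have u1: "Re u * Re u + Im u * Im u = 1" by (metis cmod_power2 one_power2 power2_eq_square)
    have "(inner v u)\<^sup>2 + (inner v (\<i> * u))\<^sup>2 = ((Re v)\<^sup>2 + (Im v)\<^sup>2) * (Re u * Re u + Im u * Im u)"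
      by (simp add: inner_complex_def power2_eq_square algebra_simps)
    then have n: "(norm v)\<^sup>2 = (inner v u)\<^sup>2 + (inner v (\<i> * u))\<^sup>2" by (simp add: u1 cmod_power2)
    have "p / of_real (norm p) = u" by (simp add: u_def sgn_eq)
    then have "gmet m p v v = (inner v u)\<^sup>2 + (m (norm p) / norm p)\<^sup>2 * (inner v (\<i> * u))\<^sup>2"
      unfolding gmet_def Let_def using False by (simp only: power2_eq_square mult.assoc if_False)
    then show ?thesis using False by (simp add: n X_def u_def[symmetric] algebra_simps)
  qed (simp add: gmet_def X_def power2_norm_eq_inner)
  have X: "isCont X r" for r
  proof (cases "r = 0")
    case True
    have "((\<lambda>h. m h / h) \<longlongrightarrow> 1) (at 0)" using has_deriv[of 0] by (simp add: DERIV_def)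
    from tendsto_diff[OF tendsto_power[OF this, of 2] tendsto_const, of 1]
    have "((\<lambda>h. (m h / h)\<^sup>2 - 1) \<longlongrightarrow> 0) (at 0)" by simp
    from Lim_transform_eventually[OF this, of X]
    have "(X \<longlongrightarrow> 0) (at 0)" by (auto simp: eventually_at_filter X_def)
    then show ?thesis using True by (simp add: isCont_def X_def)
  next
    case False
    have "isCont m r" using has_deriv DERIV_isCont by blast
    then have "((\<lambda>h. (m h / h)\<^sup>2 - 1) \<longlongrightarrow> (m r / r)\<^sup>2 - 1) (at r)" unfolding isCont_def
      using False by (intro tendsto_intros) auto
    moreover have "eventually (\<lambda>h. h \<noteq> 0) (at r)"
      by (rule eventually_neq_at_within)
    ultimately have "(X \<longlongrightarrow> X r) (at r)"
    proof -
      assume lim: "((\<lambda>h. (m h / h)\<^sup>2 - 1) \<longlongrightarrow> (m r / r)\<^sup>2 - 1) (at r)" and nz: "eventually (\<lambda>h. h \<noteq> 0) (at r)"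
      have "eventually (\<lambda>h. (m h / h)\<^sup>2 - 1 = X h) (at r)" using nz by eventually_elim (simp add: X_def)
      from Lim_transform_eventually[OF lim this] show ?thesis using False by (simp add: X_def)
    qed
    then show ?thesis by (simp add: isCont_def)
  qed
  show ?thesis unfolding gm continuous_on_def
  proof
    fix t assume t: "t \<in> S"
    have f: "(f \<longlongrightarrow> f t) (at t within S)" and g: "(g \<longlongrightarrow> g t) (at t within S)"
      using assms t by (auto simp: continuous_on_def)
    have Xf: "((\<lambda>t. X (norm (f t))) \<longlongrightarrow> X (norm (f t))) (at t within S)"
      using isCont_tendsto_compose[OF X tendsto_norm[OF f]] .
    show "((\<lambda>t. (norm (g t))\<^sup>2 + X (norm (f t)) * (inner (g t) (\<i> * sgn (f t)))\<^sup>2) \<longlongrightarrow>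
        (norm (g t))\<^sup>2 + X (norm (f t)) * (inner (g t) (\<i> * sgn (f t)))\<^sup>2) (at t within S)"
    proof (cases "f t = 0")
      case False
      then show ?thesis using f g Xf by (intro tendsto_intros)
    next
      case True
      have bound: "norm (X (norm (f s)) * (inner (g s) (\<i> * sgn (f s)))\<^sup>2) \<le> \<bar>X (norm (f s))\<bar> * (norm (g s))\<^sup>2" for s
      proof -
        have "norm (\<i> * sgn (f s)) \<le> 1" by (simp add: norm_mult norm_sgn)
        then have "\<bar>inner (g s) (\<i> * sgn (f s))\<bar> \<le> norm (g s)"
          by (meson Cauchy_Schwarz_ineq2 mult_left_le norm_ge_zero order_trans)
        then have "(inner (g s) (\<i> * sgn (f s)))\<^sup>2 \<le> (norm (g s))\<^sup>2"
          by (simp add: abs_le_square_iff[symmetric])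
        then show ?thesis by (simp add: abs_mult mult_left_mono)
      qed
      have "((\<lambda>s. \<bar>X (norm (f s))\<bar> * (norm (g s))\<^sup>2) \<longlongrightarrow> \<bar>X (norm (f t))\<bar> * (norm (g t))\<^sup>2) (at t within S)"
        using Xf g by (intro tendsto_intros)
      then have lim0: "((\<lambda>s. \<bar>X (norm (f s))\<bar> * (norm (g s))\<^sup>2) \<longlongrightarrow> 0) (at t within S)"
        using True by (simp add: X_def)
      have "((\<lambda>s. X (norm (f s)) * (inner (g s) (\<i> * sgn (f s)))\<^sup>2) \<longlongrightarrow> 0) (at t within S)"
        by (rule Lim_null_comparison[OF _ lim0]) (simp add: bound[unfolded real_norm_def] always_eventually)
      moreover have "((\<lambda>s. (norm (g s))\<^sup>2) \<longlongrightarrow> (norm (g t))\<^sup>2) (at t within S)"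
        using g by (intro tendsto_intros)
      ultimately show ?thesis using tendsto_add True by fastforce
    qed
  qed
qed

lemma speed_continuous:
  "continuous_on S f \<Longrightarrow> continuous_on S g \<Longrightarrow> continuous_on S (\<lambda>t. speed m (f t) (g t))"
  unfolding speed_def by (rule continuous_on_real_sqrt[OF gmet_continuous])

lemma speed_integrable:
  assumes "c1_curve g v a b"
  shows "(\<lambda>t. speed m (g t) (v t)) integrable_on {a..b}"
  by (rule integrable_continuous_interval[OF speed_continuous[OF c1_curveD(3,2)[OF assms]]])

lemma arc_length_combine:
  assumes "c1_curve g v a b" "a \<le> c" "c \<le> b"
  shows "arc_length m g v a b = arc_length m g v a c + arc_length m g v c b"
  unfolding arc_length_def
  using Henstock_Kurzweil_Integration.integral_combine[OF assms(2,3) speed_integrable[OF assms(1)]] by simp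

lemma arc_length_nonneg: "c1_curve g v a b \<Longrightarrow> 0 \<le> arc_length m g v a b"
  unfolding arc_length_def by (rule Henstock_Kurzweil_Integration.integral_nonneg[OF speed_integrable]) auto

text \<open>The radius need not be differentiable where the curve meets the pole, hence the regularised
  radius \<open>sqrt (r\<^sup>2 + e\<^sup>2)\<close>.\<close>

lemma arc_length_ge_radial:
  assumes c: "c1_curve g v a b" and ab: "a \<le> b"
  shows "\<bar>norm (g b) - norm (g a)\<bar> \<le> arc_length m g v a b"
proof -
  have reg: "\<bar>sqrt ((norm (g b))\<^sup>2 + e\<^sup>2) - sqrt ((norm (g a))\<^sup>2 + e\<^sup>2)\<bar> \<le> arc_length m g v a b"
    if e: "e > 0" for e
  proof -
    define f where "f = (\<lambda>t. sqrt (inner (g t) (g t) + e\<^sup>2))"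
    define f' where "f' = (\<lambda>t. inner (v t) (g t) / f t)"
    have fpos: "f t > 0" "norm (g t) \<le> f t" for t
      unfolding f_def using e by (auto simp: add_nonneg_pos power2_norm_eq_inner[symmetric] intro!: real_le_rsqrt)
    have d: "(f has_vector_derivative f' t) (at t within {a..b})" if t: "t \<in> {a..b}" for t
    proof -
      have g: "(g has_derivative (\<lambda>h. h *\<^sub>R v t)) (at t within {a..b})"
        using c1_curveD(1)[OF c t] by (simp add: has_vector_derivative_def)
      have "((\<lambda>t. inner (g t) (g t)) has_real_derivative 2 * inner (v t) (g t)) (at t within {a..b})"
        unfolding has_field_derivative_def
        by (rule has_derivative_eq_rhs[OF has_derivative_inner[OF g g]]) (simp add: fun_eq_iff inner_commute)
      from DERIV_add[OF this DERIV_const, of "e\<^sup>2"]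
      have "((\<lambda>t. inner (g t) (g t) + e\<^sup>2) has_real_derivative 2 * inner (v t) (g t)) (at t within {a..b})"
        by simp
      then have "(f has_real_derivative inverse (f t) / 2 * (2 * inner (v t) (g t))) (at t within {a..b})"
        unfolding f_def using fpos[of t] by (intro DERIV_chain2[OF DERIV_real_sqrt]) (auto simp: f_def)
      then show ?thesis
        by (simp add: has_real_derivative_iff_has_vector_derivative f'_def field_simps)
    qed
    have "continuous_on {a..b} f'" unfolding f'_def f_def
      using c1_curveD(2,3)[OF c] fpos(1) by (intro continuous_intros) (auto simp: f_def less_imp_neq[symmetric])
    then have int: "f' integrable_on {a..b}" by (rule integrable_continuous_interval)
    have "(f' has_integral f b - f a) {a..b}" by (rule fundamental_theorem_of_calculus[OF ab d])
    then have "f b - f a = integral {a..b} f'" by (simp add: integral_unique)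
    also have "\<bar>\<dots>\<bar> \<le> integral {a..b} (\<lambda>t. speed m (g t) (v t))"
    proof (rule Henstock_Kurzweil_Integration.integral_norm_bound_integral[OF int speed_integrable[OF c], unfolded real_norm_def])
      fix t
      have "\<bar>inner (v t) (g t)\<bar> \<le> f t * speed m (g t) (v t)"
        by (rule order_trans[OF inner_le_speed mult_right_mono[OF fpos(2) speed_nonneg]])
      then show "\<bar>f' t\<bar> \<le> speed m (g t) (v t)"
        unfolding f'_def using fpos(1)[of t] by (simp add: field_simps)
    qed
    finally show ?thesis unfolding f_def arc_length_def by (simp add: power2_norm_eq_inner)
  qed
  have "((\<lambda>e. \<bar>sqrt ((norm (g b))\<^sup>2 + e\<^sup>2) - sqrt ((norm (g a))\<^sup>2 + e\<^sup>2)\<bar>)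
      \<longlongrightarrow> \<bar>sqrt ((norm (g b))\<^sup>2 + 0\<^sup>2) - sqrt ((norm (g a))\<^sup>2 + 0\<^sup>2)\<bar>) (at_right 0)"
    by (intro tendsto_intros)
  then have "\<bar>sqrt ((norm (g b))\<^sup>2 + 0\<^sup>2) - sqrt ((norm (g a))\<^sup>2 + 0\<^sup>2)\<bar> \<le> arc_length m g v a b"
    by (rule tendsto_upperbound) (auto simp: eventually_at_right_less reg intro!: eventually_at_rightI[of 0 1])
  then show ?thesis by simp
qed

text \<open>With \<open>F\<close> the integral of the logarithmic derivative, g exp (- F) is
  constant. The real part of \<open>F\<close> is read off from the norms, and its imaginary part is
  the total rotation.\<close>

lemma polar_lift:
  assumes c: "c1_curve g v a b" and ab: "a \<le> b" and nz: "\<And>t. t \<in> {a..b} \<Longrightarrow> g t \<noteq> 0"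
  shows "g b = g a * of_real (norm (g b) / norm (g a)) * cis (integral {a..b} (\<lambda>t. Im (v t / g t)))"
proof -
  have cw: "continuous_on {a..b} (\<lambda>t. v t / g t)"
    using c1_curveD(2,3)[OF c] nz by (intro continuous_intros) auto
  define F where "F = (\<lambda>t. integral {a..t} (\<lambda>t. v t / g t))"
  obtain k where "\<And>t. t \<in> {a..b} \<Longrightarrow> g t * exp (- F t) = k"
  proof (rule has_vector_derivative_zero_constant[of "{a..b}" "\<lambda>t. g t * exp (- F t)"])
    fix t assume t: "t \<in> {a..b}"
    have F: "(F has_vector_derivative v t / g t) (at t within {a..b})"
      unfolding F_def using integral_has_vector_derivative[OF cw t] .
    have "((\<lambda>t. exp (- F t)) has_vector_derivative - (v t / g t) * exp (- F t)) (at t within {a..b})"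
      using field_vector_diff_chain_within[OF has_vector_derivative_minus[OF F], of exp "exp (- F t)"]
      by (simp add: o_def DERIV_exp has_field_derivative_at_within)
    from has_vector_derivative_mult[OF c1_curveD(1)[OF c t] this]
    show "((\<lambda>t. g t * exp (- F t)) has_vector_derivative 0) (at t within {a..b})"
      using nz[OF t] by simp
  qed auto
  then have "g b * exp (- F b) = g a * exp (- F a)" using ab by simp
  then have gb: "g b = g a * exp (F b)" by (simp add: F_def exp_minus field_simps)
  have "norm (g b) = norm (g a) * exp (Re (F b))" unfolding gb by (simp add: norm_mult)
  then have 1: "exp (Re (F b)) = norm (g b) / norm (g a)" using nz[of a] ab by simp
  have "(\<lambda>t. v t / g t) integrable_on {a..b}" using cw by (rule integrable_continuous_interval)
  then have "integral {a..b} (\<lambda>t. Im (v t / g t)) = Im (F b)"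
    unfolding F_def using integral_linear[OF _ bounded_linear_Im] by (auto simp: o_def)
  then show ?thesis using gb unfolding exp_eq_polar[of "F b"] 1 by (simp only: mult.assoc)
qed

text \<open>Calibration: the function with polar expression \<open>c \<theta> + H r\<close>, where \<open>H' = radial_slope m c\<close>,
  has a gradient of norm one.\<close>

lemma arc_length_ge_calibration:
  assumes c: "c1_curve g v a b" and ab: "a \<le> b"
    and low: "0 < \<rho>" "\<And>t. t \<in> {a..b} \<Longrightarrow> \<rho> \<le> norm (g t)"
    and cm: "0 \<le> c" "\<And>t. t \<in> {a..b} \<Longrightarrow> c \<le> m (norm (g t))"
    and H: "\<And>r. \<rho> \<le> r \<Longrightarrow> (H has_real_derivative radial_slope m c r) (at r)"
  shows "\<bar>H (norm (g b)) - H (norm (g a))\<bar> + c * \<bar>integral {a..b} (\<lambda>t. Im (v t / g t))\<bar> \<le> arc_length m g v a b"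
proof -
  have nz: "g t \<noteq> 0" "0 < norm (g t)" if "t \<in> {a..b}" for t 
    using low(1) low(2)[OF that] by auto
  define R where "R = (\<lambda>t. radial_slope m c (norm (g t)) * (norm (g t) * Re (v t / g t)))"
  define I where "I = (\<lambda>t. Im (v t / g t))"
  have cI: "continuous_on {a..b} I" unfolding I_def
    using c1_curveD(2,3)[OF c] nz by (intro continuous_intros) auto
  have "continuous_on {a..b} (\<lambda>t. radial_slope m c (norm (g t)))"
    by (rule continuous_on_compose2[OF radial_slope_continuous[of "{0<..}"]])
      (use c1_curveD(3)[OF c] nz in \<open>auto intro!: continuous_intros\<close>)
  then have cR: "continuous_on {a..b} R" unfolding R_def
    using c1_curveD(2,3)[OF c] nz by (intro continuous_intros) auto
  have "(R has_integral H (norm (g b)) - H (norm (g a))) {a..b}"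
  proof (rule fundamental_theorem_of_calculus[OF ab])
    fix t assume t: "t \<in> {a..b}"
    have "((\<lambda>t. H (norm (g t))) has_real_derivative R t) (at t within {a..b})"
      unfolding R_def using DERIV_chain2[OF H[OF low(2)[OF t]] norm_has_deriv[OF c1_curveD(1)[OF c t] nz(1)[OF t]]] .
    then show "((\<lambda>t. H (norm (g t))) has_vector_derivative R t) (at t within {a..b})"
      by (simp add: has_real_derivative_iff_has_vector_derivative)
  qed
  then have 1: "H (norm (g b)) - H (norm (g a)) = integral {a..b} R" by (simp add: integral_unique)
  have iR: "R integrable_on {a..b}" "(\<lambda>t. \<bar>R t\<bar>) integrable_on {a..b}"
    and iI: "I integrable_on {a..b}" "(\<lambda>t. \<bar>I t\<bar>) integrable_on {a..b}"
    using cR cI by (auto intro!: integrable_continuous_interval continuous_intros)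
  have 2: "\<bar>integral {a..b} R\<bar> \<le> integral {a..b} (\<lambda>t. \<bar>R t\<bar>)"
    and 3: "\<bar>integral {a..b} I\<bar> \<le> integral {a..b} (\<lambda>t. \<bar>I t\<bar>)"
    
    using Henstock_Kurzweil_Integration.integral_norm_bound_integral[OF iR, unfolded real_norm_def]
      Henstock_Kurzweil_Integration.integral_norm_bound_integral[OF iI, unfolded real_norm_def] by simp_all
  have "integral {a..b} (\<lambda>t. \<bar>R t\<bar> + c * \<bar>I t\<bar>) \<le> integral {a..b} (\<lambda>t. speed m (g t) (v t))"
  proof (rule integral_le)
    show "(\<lambda>t. \<bar>R t\<bar> + c * \<bar>I t\<bar>) integrable_on {a..b}"
      using cR cI by (auto intro!: integrable_continuous_interval continuous_intros)
    fix t assume t: "t \<in> {a..b}"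
    define r where "r = norm (g t)"
    define h where "h = radial_slope m c r"
    have mr: "0 < m r" "c \<le> m r" using pos nz[OF t] cm t by (auto simp: r_def)
    have h: "h\<^sup>2 = 1 - (c / m r)\<^sup>2" unfolding h_def using mr cm by (intro radial_slope_sq) auto
    define e where "e = c / m r"
    define A where "A = \<bar>r * Re (v t / g t)\<bar>"
    define B where "B = \<bar>m r * Im (v t / g t)\<bar>"
    have "\<bar>R t\<bar> + c * \<bar>I t\<bar> = h * A + e * B"
      using mr by (simp add: e_def R_def I_def A_def B_def h_def r_def[symmetric] abs_mult)
    \<comment> \<open>Cauchy-Schwarz for the unit vector (h, e), the gradient of the calibrating
      function in an orthonormal polar frame.\<close>
    also have "\<dots> \<le> sqrt (A\<^sup>2 + B\<^sup>2)"
    proof (rule real_le_rsqrt)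
      have "(h * A + e * B)\<^sup>2 + (h * B - e * A)\<^sup>2 = (h\<^sup>2 + e\<^sup>2) * (A\<^sup>2 + B\<^sup>2)"
        by (simp add: power2_eq_square algebra_simps)
      also have "h\<^sup>2 + e\<^sup>2 = 1" using h by (simp add: e_def)
      finally have "(h * A + e * B)\<^sup>2 + (h * B - e * A)\<^sup>2 = A\<^sup>2 + B\<^sup>2" by (simp only: mult_1_left)
      then show "(h * A + e * B)\<^sup>2 \<le> A\<^sup>2 + B\<^sup>2"
        by (metis le_add_same_cancel1 zero_le_power2)
    qed
    also have "sqrt (A\<^sup>2 + B\<^sup>2) = speed m (g t) (v t)"
      unfolding speed_def gmet_polar[OF nz(1)[OF t]] A_def B_def r_def by simp
    finally show "\<bar>R t\<bar> + c * \<bar>I t\<bar> \<le> speed m (g t) (v t)" .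
  qed (rule speed_integrable[OF c])
  moreover have "integral {a..b} (\<lambda>t. \<bar>R t\<bar> + c * \<bar>I t\<bar>) = integral {a..b} (\<lambda>t. \<bar>R t\<bar>) + c * integral {a..b} (\<lambda>t. \<bar>I t\<bar>)"
    using iR iI by (subst integral_add) (auto intro: integrable_on_mult_right)
  ultimately show ?thesis unfolding 1 arc_length_def I_def[symmetric]
    using 2 mult_left_mono[OF 3 cm(1)] by linarith
qed

end

section \<open>Upper bounds for the distance\<close>

definition smoothstep :: "real \<Rightarrow> real" where
  "smoothstep s = s\<^sup>2 * (3 - 2 * s)"

lemma smoothstep_range: "-1/2 \<le> s \<Longrightarrow> s \<le> 3/2 \<Longrightarrow> smoothstep s \<in> {0..1}"
proof -
  assume s: "-1/2 \<le> s" "s \<le> 3/2"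
  have "1 - smoothstep s = (1 - s)\<^sup>2 * (1 + 2 * s)"
    by (simp add: smoothstep_def power2_eq_square algebra_simps)
  moreover have "0 \<le> (1 - s)\<^sup>2 * (1 + 2 * s)" using s by simp
  moreover have "0 \<le> s\<^sup>2 * (3 - 2 * s)" using s by simp
  ultimately show ?thesis by (simp add: smoothstep_def)
qed

text \<open>Since \<^const>\<open>smoothstep\<close> maps a neighbourhood of [0, 1] to [0, 1], composing with it makes a curve
  two-sidedly differentiable at the end points, with derivative zero there.\<close>

lemma smoothstep_deriv: "(smoothstep has_real_derivative 6 * s * (1 - s)) (at s within S)"
  unfolding smoothstep_def[abs_def]
  by (auto intro!: derivative_eq_intros simp: power2_eq_square algebra_simps)

context smooth_profile
begin

text \<open>The values 0 and 1 of \<open>e\<close> move a curve to the left and to the right half of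
  [0, 1]. As the new velocity vanishes at both ends, two such halves fit together in a C1
  way.\<close>

lemma smoothstep_reparametrisation:
  fixes e :: real
  assumes g: "c1_curve g v a b" and ab: "a < b"
  defines "\<sigma> \<equiv> \<lambda>s. a + (b - a) * smoothstep (2 * s - e)"
  defines "w \<equiv> \<lambda>s. (12 * (2 * s - e) * (1 - (2 * s - e)) * (b - a)) *\<^sub>R v (\<sigma> s)"
  shows "\<And>s. s \<in> {e/2 .. (e + 1)/2} \<Longrightarrow> ((\<lambda>s. g (\<sigma> s)) has_vector_derivative w s) (at s)"
    and "continuous_on {e/2 .. (e + 1)/2} w"
    and "integral {e/2 .. (e + 1)/2} (\<lambda>s. speed m (g (\<sigma> s)) (w s)) = arc_length m g v a b"
    and "g (\<sigma> (e/2)) = g a" and "g (\<sigma> ((e + 1)/2)) = g b"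
    and "w (e/2) = 0" and "w ((e + 1)/2) = 0"
proof -
  define \<sigma>' where "\<sigma>' = (\<lambda>s. 12 * (2 * s - e) * (1 - (2 * s - e)) * (b - a))"
  define J where "J = {e/2 .. (e + 1)/2}"
  have d\<sigma>: "(\<sigma> has_real_derivative \<sigma>' s) (at s within S)" for s S
  proof -
    have "((\<lambda>s. 2 * s - e) has_real_derivative 2) (at s within S)"
      by (auto intro!: derivative_eq_intros)
    from DERIV_chain2[OF smoothstep_deriv this]
    have "((\<lambda>s. smoothstep (2 * s - e)) has_real_derivative 6 * (2 * s - e) * (1 - (2 * s - e)) * 2) (at s within S)" .
    from DERIV_add[OF DERIV_const DERIV_cmult[OF this], of a "b - a"]
    show ?thesis unfolding \<sigma>_def \<sigma>'_def by (rule DERIV_cong) (simp add: algebra_simps)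
  qed
  \<comment> \<open>The margin 1/4 in \<open>s\<close> is a margin 1/2 in the argument 2 s - e,
    exactly what \<open>smoothstep_range\<close> permits. So the curve is evaluated inside [a, b] on
    a whole neighbourhood of each end point.\<close>
  define U where "U = {e/2 - 1/4 <..< (e + 1)/2 + 1/4}"
  have \<sigma>U: "\<sigma> s \<in> {a..b}" if "s \<in> U" for s
  proof -
    have r: "0 \<le> smoothstep (2 * s - e)" "smoothstep (2 * s - e) \<le> 1"
      using smoothstep_range[of "2 * s - e"] that by (auto simp: U_def field_simps)
    have "(b - a) * smoothstep (2 * s - e) \<le> (b - a) * 1" "0 \<le> (b - a) * smoothstep (2 * s - e)"
      using ab r by (auto intro: mult_left_mono)
    then have "a \<le> \<sigma> s" "\<sigma> s \<le> b" unfolding \<sigma>_def by simp_all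
    then show ?thesis by simp
  qed
  have JU: "J \<subseteq> U"
    unfolding J_def U_def by (rule subsetI, unfold atLeastAtMost_iff greaterThanLessThan_iff) linarith
  show "((\<lambda>s. g (\<sigma> s)) has_vector_derivative w s) (at s)" if "s \<in> {e/2 .. (e + 1)/2}" for s
  proof -
    have s: "s \<in> U" using that JU by (auto simp: J_def)
    have "(g \<circ> \<sigma> has_vector_derivative \<sigma>' s *\<^sub>R v (\<sigma> s)) (at s within U)"
    proof (rule vector_diff_chain_within)
      show "(\<sigma> has_vector_derivative \<sigma>' s) (at s within U)"
        using d\<sigma> by (simp add: has_real_derivative_iff_has_vector_derivative)
      show "(g has_vector_derivative v (\<sigma> s)) (at (\<sigma> s) within \<sigma> ` U)"
        by (rule has_vector_derivative_within_subset[OF c1_curveD(1)[OF g \<sigma>U[OF s]]]) (use \<sigma>U in auto)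
    qed
    moreover have "at s within U = at s" using s by (intro at_within_open) (auto simp: U_def)
    ultimately show ?thesis by (simp add: o_def w_def \<sigma>'_def)
  qed
  have c\<sigma>: "continuous_on J \<sigma>"
    by (rule DERIV_continuous_on[OF d\<sigma>])
  have \<sigma>J: "\<sigma> ` J \<subseteq> {a..b}" using \<sigma>U JU by auto
  have "continuous_on J (\<lambda>s. v (\<sigma> s))"
    by (rule continuous_on_compose2[OF c1_curveD(2)[OF g] c\<sigma> \<sigma>J])
  then show "continuous_on {e/2 .. (e + 1)/2} w"
    unfolding w_def J_def by (intro continuous_intros)
  have u: "2 * (e / 2) - e = 0" "2 * ((e + 1) / 2) - e = 1" by (simp_all add: field_simps)
  have ends: "\<sigma> (e/2) = a" "\<sigma> ((e + 1)/2) = b"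
    unfolding \<sigma>_def u smoothstep_def by simp_all
  then show "g (\<sigma> (e/2)) = g a" "g (\<sigma> ((e + 1)/2)) = g b" by simp_all
  show "w (e/2) = 0" "w ((e + 1)/2) = 0" unfolding w_def u by simp_all
  have "((\<lambda>s. \<sigma>' s *\<^sub>R speed m (g (\<sigma> s)) (v (\<sigma> s))) has_integral
      integral {\<sigma> (e/2)..\<sigma> ((e + 1)/2)} (\<lambda>t. speed m (g t) (v t))) {e/2..(e + 1)/2}"
  proof (rule has_integral_substitution)
    show "\<sigma> ` {e/2..(e + 1)/2} \<subseteq> {a..b}" using \<sigma>J by (simp add: J_def)
    show "continuous_on {a..b} (\<lambda>t. speed m (g t) (v t))" by (rule speed_continuous[OF c1_curveD(3,2)[OF g]])
  qed (use ends ab d\<sigma> in auto)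
  moreover have "\<sigma>' s *\<^sub>R speed m (g (\<sigma> s)) (v (\<sigma> s)) = speed m (g (\<sigma> s)) (w s)" if "s \<in> {e/2..(e + 1)/2}" for s
  proof -
    have "0 \<le> \<sigma>' s" unfolding \<sigma>'_def using that ab by (intro mult_nonneg_nonneg) auto
    then show ?thesis unfolding w_def \<sigma>'_def[symmetric] by (simp add: speed_scaleR \<sigma>'_def)
  qed
  ultimately have "((\<lambda>s. speed m (g (\<sigma> s)) (w s)) has_integral arc_length m g v a b) {e/2..(e + 1)/2}"
    unfolding arc_length_def ends by (rule has_integral_eq[rotated])
  then show "integral {e/2 .. (e + 1)/2} (\<lambda>s. speed m (g (\<sigma> s)) (w s)) = arc_length m g v a b"
    by (rule integral_unique)
qed

lemma concatenation:
  assumes g: "c1_curve g v a b" "a < b" and h: "c1_curve h u c d" "c < d" and gh: "g b = h c"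
  obtains k where "k C1_differentiable_on {0..1}" "k 0 = g a" "k 1 = h d"
    "mlength m k = arc_length m g v a b + arc_length m h u c d"
proof -
  define \<sigma> where "\<sigma> s = a + (b - a) * smoothstep (2 * s - 0)" for s
  define w where "w s = (12 * (2 * s - 0) * (1 - (2 * s - 0)) * (b - a)) *\<^sub>R v (\<sigma> s)" for s
  define \<tau> where "\<tau> s = c + (d - c) * smoothstep (2 * s - 1)" for s
  define z where "z s = (12 * (2 * s - 1) * (1 - (2 * s - 1)) * (d - c)) *\<^sub>R u (\<tau> s)" for s
  note G = smoothstep_reparametrisation[OF g, where e = 0, folded \<sigma>_def, folded w_def, unfolded div_0 add_0]
  note H = smoothstep_reparametrisation[OF h, where e = 1, folded \<tau>_def, folded z_def,
    unfolded one_add_one divide_self_if, simplified numeral_neq_zero if_False]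
  define k where "k = (\<lambda>s. if s \<in> {..1/2} then g (\<sigma> s) else h (\<tau> s))"
  define D where "D = (\<lambda>s. if s \<in> {..1/2} then w s else z s)"
  have joint: "g (\<sigma> s) = h (\<tau> s)" "w s = z s" if "1/2 \<le> s" "s \<le> 1/2" for s
  proof -
    have s: "s = 1/2" using that by linarith
    show "g (\<sigma> s) = h (\<tau> s)" "w s = z s" unfolding s using G(4-) H(4-) gh by simp_all
  qed
  have cl: "closure {1/2<..} = {1/2::real..}" by simp
  have k: "(k has_vector_derivative D s) (at s)" if s: "s \<in> {0..1}" for s
    unfolding k_def D_def
  proof (rule has_vector_derivative_If_within_closures[where T = "{1/2<..}"])
    show "((\<lambda>s. g (\<sigma> s)) has_vector_derivative w s) (at s within {..1/2} \<union> closure {..1/2} \<inter> closure {1/2<..})"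
      if "s \<in> {..1/2} \<union> closure {..1/2} \<inter> closure {1/2<..}"
      using G(1)[of s] s that by (auto simp: cl intro: has_vector_derivative_at_within)
    show "((\<lambda>s. h (\<tau> s)) has_vector_derivative z s) (at s within {1/2<..} \<union> closure {..1/2} \<inter> closure {1/2<..})"
      if "s \<in> {1/2<..} \<union> closure {..1/2} \<inter> closure {1/2<..}"
      using H(1)[of s] s that by (auto simp: cl intro: has_vector_derivative_at_within)
    show "g (\<sigma> s) = h (\<tau> s)" "w s = z s" if "s \<in> closure {..1/2}" "s \<in> closure {1/2<..}"
      using that joint[of s] unfolding cl by simp_all
  qed auto
  have "continuous_on ({0..1/2} \<union> {1/2..1}) D"
    unfolding D_def using G(2) H(2) joint(2) by (intro continuous_on_cases) auto
  then have cD: "continuous_on {0..1} D" by (rule continuous_on_subset) auto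
  have 1: "k C1_differentiable_on {0..1}" unfolding C1_differentiable_on_def using k cD by blast
  have c1: "c1_curve k D 0 1" unfolding c1_curve_def using k cD by (auto intro: has_vector_derivative_at_within)
  have "mlength m k = arc_length m k D 0 1"
    unfolding mlength_def arc_length_def speed_def
    by (intro integral_cong) (simp add: vector_derivative_at[OF k])
  also have "\<dots> = arc_length m k D 0 (1/2) + arc_length m k D (1/2) 1"
    by (rule arc_length_combine[OF c1]) auto
  also have "arc_length m k D 0 (1/2) = arc_length m g v a b"
    unfolding G(3)[symmetric] unfolding arc_length_def by (intro integral_cong) (simp add: k_def D_def)
  also have "arc_length m k D (1/2) 1 = arc_length m h u c d"
    unfolding H(3)[symmetric] unfolding arc_length_def
  proof (intro integral_cong)
    fix s :: real assume "s \<in> {1/2..1}"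
    then show "speed m (k s) (D s) = speed m (h (\<tau> s)) (z s)"
      using joint[of s] by (auto simp: k_def D_def)
  qed
  finally show ?thesis using 1 that[of k] G(4) H(5) by (simp add: k_def)
qed

section \<open>From lengths of curves to the distance\<close>

lemma mlength_nonneg: "0 \<le> mlength m g"
  unfolding mlength_def
  \<comment> \<open>An integrand that is not integrable has integral 0 by default, which is
    nonnegative as well.\<close>
  by (cases "(\<lambda>t. sqrt (gmet m (g t) (vector_derivative g (at t)) (vector_derivative g (at t)))) integrable_on {0..1}")
    (auto intro: Henstock_Kurzweil_Integration.integral_nonneg simp: gmet_nonneg not_integrable_integral)

lemma mdist_le:
  assumes g: "c1_curve g v a b" "a < b" and h: "c1_curve h u c d" "c < d" and gh: "g b = h c"
  shows "mdist m (g a) (h d) \<le> arc_length m g v a b + arc_length m h u c d"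
proof -
  obtain k where k: "k C1_differentiable_on {0..1}" "k 0 = g a" "k 1 = h d"
    "mlength m k = arc_length m g v a b + arc_length m h u c d"
    using concatenation[OF assms] .
  have "mdist m (g a) (h d) \<le> mlength m k"
    unfolding mdist_def using k(1-3) mlength_nonneg by (intro cInf_lower bdd_belowI[of _ 0]) auto
  then show ?thesis using k(4) by simp
qed

lemma meridian_to_pole: "c1_curve (\<lambda>t. (1 - t) *\<^sub>R p) (\<lambda>t. - p) 0 1"
  and meridian_from_pole: "c1_curve (\<lambda>t. t *\<^sub>R q) (\<lambda>t. q) 0 1"
  unfolding c1_curve_def by (auto intro!: derivative_eq_intros)

text \<open>Two cases, because at the pole the metric is Euclidean by definition, while elsewhere
  only the radial part of the polar form is present. The speed is the same in both.\<close>

lemma speed_meridian: "speed m (t *\<^sub>R q) (c *\<^sub>R q) = \<bar>c\<bar> * norm q"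
proof (cases "t *\<^sub>R q = 0")
  case True
  then have "speed m (t *\<^sub>R q) q = norm q" by (simp add: speed_def gmet_def norm_eq_sqrt_inner)
  then show ?thesis by (simp add: speed_scaleR)
next
  case False
  have "q / (t *\<^sub>R q) = of_real (1 / t)" using False by (simp add: scaleR_conv_of_real)
  then have "gmet m (t *\<^sub>R q) q q = (norm q)\<^sup>2" using False
    unfolding gmet_polar[OF False] by (simp add: power_mult_distrib power_divide)
  then have "speed m (t *\<^sub>R q) q = norm q" by (simp add: speed_def)
  then show ?thesis by (simp add: speed_scaleR)
qed

lemma arc_length_meridian:
  "arc_length m (\<lambda>t. (1 - t) *\<^sub>R p) (\<lambda>t. - p) 0 1 = norm p"
  "arc_length m (\<lambda>t. t *\<^sub>R q) (\<lambda>t. q) 0 1 = norm q"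
  using speed_meridian[of _ p "-1"] speed_meridian[of _ q 1] by (simp_all add: arc_length_def)

lemma mdist_le_via_pole: "mdist m p q \<le> norm p + norm q"
  using mdist_le[OF meridian_to_pole _ meridian_from_pole, of p q] by (simp add: arc_length_meridian)

text \<open>Nothing is assumed about the infimum being attained, so distances are tested on curves
  of nearly minimal length. The path through the pole shows that the infimum is taken over a
  nonempty set.\<close>

lemma near_minimal_curve:
  assumes "mdist m p q < L"
  obtains g v where "c1_curve g v 0 1" "g 0 = p" "g 1 = q" "arc_length m g v 0 1 < L"
proof -
  obtain k where k: "k C1_differentiable_on {0..1}" "k 0 = p" "k 1 = q"
    by (rule concatenation[OF meridian_to_pole _ meridian_from_pole, of p q]) auto
  then have ne: "{mlength m g |g. g C1_differentiable_on {0..1} \<and> g 0 = p \<and> g 1 = q} \<noteq> {}" by blast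
  obtain g where g: "g C1_differentiable_on {0..1}" "g 0 = p" "g 1 = q" "mlength m g < L"
    using cInf_lessD[OF ne assms[unfolded mdist_def]] by blast
  then obtain v where v: "\<forall>t\<in>{0..1}. (g has_vector_derivative v t) (at t)" "continuous_on {0..1} v"
    unfolding C1_differentiable_on_def by blast
  have c: "c1_curve g v 0 1" unfolding c1_curve_def using v by (auto intro: has_vector_derivative_at_within)
  have "mlength m g = arc_length m g v 0 1"
    unfolding mlength_def arc_length_def speed_def
    by (intro integral_cong) (use v(1) vector_derivative_at in force)
  then show ?thesis using that c g by simp
qed

text \<open>A piece of a geodesic with Clairaut constant \<open>c\<close>, parametrised by the radius.\<close>

lemma outward_geodesic:
  assumes aY: "0 < a" "a < Y" and c: "0 \<le> c" "\<forall>r\<in>{a..Y}. c < m r" and q: "norm q = a"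
    and \<tau>: "\<bar>\<tau>\<bar> = integral {a..Y} (turn_rate m c)"
  obtains g v where "c1_curve g v a Y" "g a = q" "g Y = q * of_real (Y / a) * cis \<tau>"
    "arc_length m g v a Y = c * \<bar>\<tau>\<bar> + integral {a..Y} (radial_slope m c)"
proof -
  define j where "j = turn_rate m c"
  define sg :: real where "sg = (if \<tau> \<ge> 0 then 1 else -1)"
  have h: "0 < radial_slope m c r" if "r \<in> {a..Y}" for r
    using radial_slope_pos c that by auto
  have mp: "0 < m r" if "r \<in> {a..Y}" for r using pos that aY by auto
  have cj: "continuous_on {a..Y} j"
    unfolding j_def turn_rate_def[abs_def]
  proof (intro continuous_intros radial_slope_continuous continuous)
    show "\<forall>x\<in>{a..Y}. (m x)\<^sup>2 * radial_slope m c x \<noteq> 0" using h mp by force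
  qed (use aY in auto)
  define \<phi> where "\<phi> = (\<lambda>r. integral {a..r} j)"
  have d\<phi>: "(\<phi> has_vector_derivative j r) (at r within {a..Y})" if "r \<in> {a..Y}" for r
    unfolding \<phi>_def using integral_has_vector_derivative[OF cj that] .
  define g where "g = (\<lambda>r. q / of_real a * (of_real r * cis (sg * \<phi> r)))"
  define v where "v = (\<lambda>r. q / of_real a * (cis (sg * \<phi> r) * (1 + \<i> * of_real (sg * (r * j r)))))"
  have "c1_curve g v a Y"
    unfolding c1_curve_def
  proof (intro conjI ballI)
    fix r assume r: "r \<in> {a..Y}"
    have 1: "((\<lambda>r. complex_of_real r) has_vector_derivative of_real 1) (at r within {a..Y})"
      by (intro has_vector_derivative_of_real DERIV_ident)
    have "((\<lambda>r. \<i> * of_real (sg * \<phi> r)) has_vector_derivative \<i> * of_real (sg * j r)) (at r within {a..Y})"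
      using d\<phi>[OF r] unfolding has_real_derivative_iff_has_vector_derivative[symmetric]
      by (intro has_vector_derivative_mult_right has_vector_derivative_of_real DERIV_cmult)
    from field_vector_diff_chain_within[OF this, of exp "exp (\<i> * of_real (sg * \<phi> r))"]
    have 2: "((\<lambda>r. cis (sg * \<phi> r)) has_vector_derivative \<i> * of_real (sg * j r) * cis (sg * \<phi> r)) (at r within {a..Y})"
      by (simp add: o_def DERIV_exp has_field_derivative_at_within cis_conv_exp)
    from has_vector_derivative_mult_right[OF has_vector_derivative_mult[OF 1 2], of "q / of_real a"]
    show "(g has_vector_derivative v r) (at r within {a..Y})"
      unfolding g_def v_def by (simp add: algebra_simps)
  next
    have "continuous_on {a..Y} \<phi>" by (rule continuous_on_vector_derivative[OF d\<phi>])
    then show "continuous_on {a..Y} v"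
      unfolding v_def using aY by (intro continuous_intros cj) auto
  qed
  moreover have "g a = q" using aY by (simp add: g_def \<phi>_def)
  moreover have "\<phi> Y = \<bar>\<tau>\<bar>" using \<tau> by (simp add: \<phi>_def j_def)
  then have "sg * \<phi> Y = \<tau>" by (simp add: sg_def)
  then have "g Y = q * of_real (Y / a) * cis \<tau>" by (simp add: g_def)
  moreover have "arc_length m g v a Y = c * \<bar>\<tau>\<bar> + integral {a..Y} (radial_slope m c)"
  proof -
    have sp: "speed m (g r) (v r) = c * j r + radial_slope m c r" if r: "r \<in> {a..Y}" for r
    proof -
      have q0: "q \<noteq> 0" "r \<noteq> 0" "r > 0" using q aY r by auto
      have ng: "norm (g r) = r" using q q0 aY by (simp add: g_def norm_mult norm_divide)
      have g0: "g r \<noteq> 0" using ng q0 by auto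
      have "v r / g r = (1 + \<i> * of_real (sg * (r * j r))) / of_real r"
        using q0 aY by (simp add: g_def v_def)
      then have Re: "Re (v r / g r) = 1 / r" and Im: "Im (v r / g r) = sg * j r"
        using q0 by (simp_all add: Re_divide_of_real Im_divide_of_real)
      define H where "H = radial_slope m c r"
      have H: "H > 0" "H\<^sup>2 = 1 - (c / m r)\<^sup>2"
        unfolding H_def using h[OF r] c(1) bspec[OF c(2) r] mp[OF r]
        by (auto intro!: radial_slope_sq)
      have mj: "m r * j r = c / m r / H" unfolding j_def turn_rate_def H_def[symmetric]
        using mp[OF r] by (simp add: power2_eq_square)
      have "gmet m (g r) (v r) (v r) = 1 + (m r * j r)\<^sup>2"
        unfolding gmet_polar[OF g0] ng Re Im using q0 by (simp add: sg_def)
      also have "\<dots> = (H\<^sup>2 + (c / m r)\<^sup>2) / H\<^sup>2" unfolding mj using H(1) by (simp add: field_simps)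
      also have "H\<^sup>2 + (c / m r)\<^sup>2 = 1" using H(2) by simp
      also have "1 / H\<^sup>2 = (1 / H)\<^sup>2" by (simp add: power_divide)
      finally have "speed m (g r) (v r) = 1 / H" unfolding speed_def using H(1) by simp
      \<comment> \<open>The speed 1 / H splits as (1 - H^2) / H + H, the part from the rotation and
        the radial action.\<close>
      also have "\<dots> = c * j r + H"
      proof -
        have "c * j r = (c / m r)\<^sup>2 / H" unfolding j_def turn_rate_def H_def[symmetric]
          by (simp add: power2_eq_square)
        also have "\<dots> = (1 - H\<^sup>2) / H" unfolding H(2) by simp
        finally show ?thesis using H(1) by (simp add: field_simps power2_eq_square)
      qed
      finally show ?thesis by (simp add: H_def)
    qed
    have "arc_length m g v a Y = integral {a..Y} (\<lambda>r. c * j r + radial_slope m c r)"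
      unfolding arc_length_def by (rule integral_cong[OF sp])
    also have "\<dots> = integral {a..Y} (\<lambda>r. c * j r) + integral {a..Y} (radial_slope m c)"
      using aY cj by (intro integral_add integrable_continuous_interval continuous_intros radial_slope_continuous) auto
    finally show ?thesis using \<tau> by (simp add: j_def)
  qed
  ultimately show ?thesis using that by blast
qed

end

section \<open>Rays start outward\<close>

text \<open>If the right-hand side is at least pi, the range of the principal argument suffices.
  Otherwise no wrap-around can occur and the arguments add.\<close>

lemma abs_Arg_rotate_le:
  assumes "z \<noteq> 0" "0 < s"
  shows "\<bar>Arg (z * of_real s * cis \<omega>)\<bar> \<le> \<bar>Arg z\<bar> + \<bar>\<omega>\<bar>"
proof (cases "\<bar>Arg z\<bar> + \<bar>\<omega>\<bar> < pi")
  case True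
  have "z * of_real s * cis \<omega> = rcis (norm z) (Arg z) * rcis s \<omega>"
    by (simp add: rcis_cmod_Arg) (simp add: rcis_def)
  also have "\<dots> = rcis (norm z * s) (Arg z + \<omega>)" by (rule rcis_mult)
  finally have e: "z * of_real s * cis \<omega> = rcis (norm z * s) (Arg z + \<omega>)" .
  have "Arg (z * of_real s * cis \<omega>) = Arg z + \<omega>"
  proof -
    have "- pi < Arg z + \<omega>" using True by linarith
    moreover have "Arg z + \<omega> \<le> pi" using True by linarith
    moreover have "0 < norm z * s" using assms by simp
    ultimately show ?thesis unfolding e by (intro Arg_rcis) simp_all
  qed
  then show ?thesis by simp
next
  case False
  then show ?thesis using Arg_bounded[of "z * of_real s * cis \<omega>"] by linarith
qed

context smooth_profile
begin

text \<open>Starting the integral at \<open>\<rho> / 2\<close> makes \<open>\<rho>\<close> an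
  interior point, so the derivative there is two-sided, as the calibration requires.\<close>

lemma radial_slope_primitive:
  fixes \<rho> c :: real
  assumes "0 < \<rho>"
  defines "H \<equiv> \<lambda>r. integral {\<rho>/2..r} (radial_slope m c)"
  shows "\<And>r. \<rho> \<le> r \<Longrightarrow> (H has_real_derivative radial_slope m c r) (at r)"
    and "\<And>r s. \<rho> \<le> r \<Longrightarrow> r \<le> s \<Longrightarrow> integral {r..s} (radial_slope m c) = H s - H r"
    and "\<And>r s. \<rho> \<le> r \<Longrightarrow> r \<le> s \<Longrightarrow> H s - H r \<in> {0..s - r}"
proof -
  show "(H has_real_derivative radial_slope m c r) (at r)" if r: "\<rho> \<le> r" for r
  proof -
    have "continuous_on {\<rho>/2..r + 1} (radial_slope m c)"
      using assms by (intro radial_slope_continuous) auto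
    from integral_has_real_derivative[OF this, of r]
    have "(H has_real_derivative radial_slope m c r) (at r within {\<rho>/2..r + 1})"
      unfolding H_def using r assms by simp
    moreover have "at r within {\<rho>/2..r + 1} = at r"
      using r assms by (intro at_within_interior) auto
    ultimately show ?thesis by simp
  qed
  show *: "integral {r..s} (radial_slope m c) = H s - H r" if "\<rho> \<le> r" "r \<le> s" for r s
    using Henstock_Kurzweil_Integration.integral_combine[of "\<rho>/2" r s "radial_slope m c"]
      radial_slope_integrable[of "\<rho>/2" c s] that assms by (simp add: H_def)
  show "H s - H r \<in> {0..s - r}" if rs: "\<rho> \<le> r" "r \<le> s" for r s
  proof -
    have i: "radial_slope m c integrable_on {r..s}" using rs assms by (intro radial_slope_integrable) auto
    have "integral {r..s} (radial_slope m c) \<le> integral {r..s} (\<lambda>_. 1)"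
      using i by (intro integral_le) auto
    moreover have "0 \<le> integral {r..s} (radial_slope m c)"
      using i by (intro Henstock_Kurzweil_Integration.integral_nonneg) auto
    ultimately show ?thesis using *[OF rs] rs by simp
  qed
qed

lemma radius_with_value:
  assumes Y: "\<forall>t\<in>{0..Y}. deriv m t > 0" and "0 < c" "c < m a" "0 < a"
  obtains \<rho> where "0 < \<rho>" "\<rho> < a" "m \<rho> = c"
proof -
  obtain \<rho> where "0 \<le> \<rho>" "\<rho> \<le> a" "m \<rho> = c"
    using IVT'[of m 0 c a] assms continuous by auto
  moreover have "\<rho> \<noteq> 0" "\<rho> \<noteq> a" using assms \<open>m \<rho> = c\<close> by auto
  ultimately show ?thesis using that[of \<rho>] by simp
qed

text \<open>No continuous angle function has to be chosen: it is enough to follow the absolute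
  principal argument relative to \<open>q\<close>.\<close>

lemma polar_lift_arg:
  assumes g: "c1_curve g v a b" and ab: "a \<le> b" and nz: "\<And>t. t \<in> {a..b} \<Longrightarrow> g t \<noteq> 0" and q: "q \<noteq> 0"
  shows "\<bar>Arg (g b / q)\<bar> \<le> \<bar>Arg (g a / q)\<bar> + \<bar>integral {a..b} (\<lambda>t. Im (v t / g t))\<bar>"
proof -
  have nz': "g a \<noteq> 0" "g b \<noteq> 0" using nz ab by auto
  have "g b / q = (g a / q) * of_real (norm (g b) / norm (g a)) * cis (integral {a..b} (\<lambda>t. Im (v t / g t)))"
    by (subst polar_lift[OF g ab nz]) (simp_all add: field_simps)
  then show ?thesis using abs_Arg_rotate_le[of "g a / q" "norm (g b) / norm (g a)"] nz' q by simp
qed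

text \<open>A curve staying at radius at least \<open>\<rho>\<close> with \<open>m \<rho> = c\<close> is compared with the calibration of
  Clairaut constant \<open>c\<close>; one coming closer to the pole is calibrated on the two sides of its nearest
  point, with the Clairaut constant determined by that point.\<close>

lemma curve_to_boundary:
  assumes vm: "von_mangoldt m" and Y: "\<forall>t\<in>{0..Y}. deriv m t > 0"
    and b: "0 < b" "b < 1/2" "\<forall>t\<in>{a..y}. deriv m t \<le> b"
    and ay: "0 < a" "a < y" "y < Y" "m a \<le> cos (pi * b) * m y"
    and C: "0 < C" "C < m a" "pi \<le> integral {a..Y} (turn_rate m C)"
    and R: "0 < R" "R < a" "m R = C"
    and q: "norm q = a"
    and g: "c1_curve g v s0 s1" "s0 \<le> s1" and gY: "\<And>t. t \<in> {s0..s1} \<Longrightarrow> norm (g t) \<le> Y" "norm (g s1) = Y"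
    and near: "C * \<bar>Arg (g s0 / q)\<bar> + \<bar>norm (g s0) - a\<bar> \<le> 2 * integral {R..a} (radial_slope m C)"
  obtains c where "0 \<le> c" "c \<le> C" "\<bar>Arg (g s1 / q)\<bar> = integral {a..Y} (turn_rate m c)"
    "c * \<bar>Arg (g s1 / q)\<bar> + integral {a..Y} (radial_slope m c)
      \<le> arc_length m g v s0 s1 + C * \<bar>Arg (g s0 / q)\<bar> + max 0 (norm (g s0) - a)"
proof -
  define th where "th = \<bar>Arg (g s1 / q)\<bar>"
  define al where "al = \<bar>Arg (g s0 / q)\<bar>"
  have q0: "q \<noteq> 0" using q ay by auto
  have al0: "0 \<le> al" by (simp add: al_def)
  have th: "0 \<le> th" "th \<le> pi" using Arg_bounded[of "g s1 / q"] by (auto simp: th_def)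
  have mY: "\<forall>t\<in>{a..Y}. C < m t" 
  proof
    fix t assume "t \<in> {a..Y}"
    then have "m a \<le> m t" using mono[OF Y, of a t] ay by simp
    then show "C < m t" using C by linarith
  qed
  have "th \<le> integral {a..Y} (turn_rate m C)" using C th by linarith
  then obtain c where c: "0 \<le> c" "c \<le> C" "integral {a..Y} (turn_rate m c) = th"
    by (rule turning_angle_attained[OF ay(1) less_imp_le[OF C(1)] mY th(1)])
  define L where "L = c * th + integral {a..Y} (radial_slope m c)"
  have cal: "c * al \<le> C * al" using c al0 by (simp add: mult_right_mono)
  have cont: "continuous_on {s0..s1} (\<lambda>t. norm (g t))"
    using c1_curveD(3)[OF g(1)] by (intro continuous_intros)
  obtain u where u: "u \<in> {s0..s1}" and umin: "\<And>t. t \<in> {s0..s1} \<Longrightarrow> norm (g u) \<le> norm (g t)"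
    using continuous_attains_inf[of "{s0..s1}" "\<lambda>t. norm (g t)"] cont g(2) by auto
  define r where "r = norm (g u)"
  have g1: "c1_curve g v s0 u" and g2: "c1_curve g v u s1"
    using u by (auto intro: c1_curve_subset[OF g(1)])
  have arc: "arc_length m g v s0 s1 = arc_length m g v s0 u + arc_length m g v u s1"
    using u by (intro arc_length_combine[OF g(1)]) auto
  have rq: "r \<le> norm (g s0)" unfolding r_def using umin g(2) by simp
  have "L \<le> arc_length m g v s0 s1 + C * al + max 0 (norm (g s0) - a)"
  proof (cases "c = 0")
    case True
    \<comment> \<open>With constant 0 the comparison geodesic is a piece of a meridian, of length Y
      - a.\<close>
    have "radial_slope m 0 = (\<lambda>_. 1)" by (auto simp: radial_slope_def)
    then have "L = Y - a" using ay True by (simp add: L_def)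
    moreover have "Y - norm (g s0) \<le> arc_length m g v s0 s1"
      using arc_length_ge_radial[OF g] gY by simp
    moreover have "0 \<le> C * al" using C al0 by simp
    ultimately show ?thesis by linarith
  next
    case False
    then have c0: "0 < c" "c < m a" using c C by auto
    obtain \<rho> where \<rho>: "0 < \<rho>" "\<rho> < a" "m \<rho> = c" using radius_with_value[OF Y c0 ay(1)] .
    have \<rho>R: "\<rho> \<le> R"
    proof (rule ccontr)
      assume "\<not> \<rho> \<le> R"
      then have "m R < m \<rho>" using strict_mono[OF Y, of R \<rho>] R \<rho> ay by auto
      then show False using \<rho> R c by simp
    qed
    show ?thesis
    proof (cases "\<rho> \<le> r")
      case True
      define H where "H t = integral {\<rho>/2..t} (radial_slope m c)" for t
      note H = radial_slope_primitive[OF \<rho>(1), where c = c, folded H_def]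
      define w where "w = \<bar>integral {s0..s1} (\<lambda>t. Im (v t / g t))\<bar>"
      have low: "\<rho> \<le> norm (g t)" if "t \<in> {s0..s1}" for t using umin[OF that] True by (simp add: r_def)
      have nz: "g t \<noteq> 0" if "t \<in> {s0..s1}" for t using low[OF that] \<rho> by auto
      have cm: "c \<le> m (norm (g t))" if "t \<in> {s0..s1}" for t
        using mono[OF Y, of \<rho> "norm (g t)"] low[OF that] gY(1)[OF that] \<rho> by simp
      have "\<bar>H (norm (g s1)) - H (norm (g s0))\<bar> + c * w \<le> arc_length m g v s0 s1"
        unfolding w_def by (rule arc_length_ge_calibration[OF g \<rho>(1) low c(1) cm H(1)])
      then have 1: "H Y - H (norm (g s0)) + c * w \<le> arc_length m g v s0 s1" using gY by simp
      have "th \<le> al + w" unfolding th_def al_def w_def by (rule polar_lift_arg[OF g nz q0])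
      then have "c * th \<le> c * (al + w)" using c by (intro mult_left_mono)
      then have 2: "c * th \<le> c * al + c * w" by (simp add: distrib_left)
      have 3: "integral {a..Y} (radial_slope m c) = H Y - H a" using H(2)[of a Y] \<rho> ay by simp
      have "H (norm (g s0)) - H a \<le> max 0 (norm (g s0) - a)"
      proof (cases "a \<le> norm (g s0)")
        case True
        then show ?thesis using H(3)[of a "norm (g s0)"] \<rho> by simp
      next
        case False
        then show ?thesis using H(3)[of "norm (g s0)" a] rq \<open>\<rho> \<le> r\<close> by simp
      qed
      then show ?thesis unfolding L_def using 1 2 3 cal by linarith
    next
      case False
      \<comment> \<open>\<open>W s\<close> is the radial action of the geodesic that goes in from
        radius \<open>a\<close> to its turning radius \<open>s\<close> and then out to
        \<open>Y\<close>.\<close>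
      define W where "W s = 2 * integral {s..a} (radial_slope m (m s)) + integral {a..Y} (radial_slope m (m s))" for s
      \<comment> \<open>A lower bound, independent of \<open>c\<close>, for the extra action of
        going in and coming out again. By hypothesis it absorbs the displacement of the starting
        point of \<open>g\<close> from \<open>q\<close>.\<close>
      define \<eta> where "\<eta> = 2 * integral {R..a} (radial_slope m C)"
      have W\<rho>: "W \<rho> + c * th \<ge> L + \<eta>"
      proof -
        have "integral {R..a} (radial_slope m C) \<le> integral {R..a} (radial_slope m c)"
          using R c pos by (intro integral_le radial_slope_integrable radial_slope_antimono) auto
        also have "\<dots> \<le> integral {\<rho>..a} (radial_slope m c)"
          using \<rho>R R \<rho> by (intro integral_subset_le radial_slope_integrable) auto
        finally show ?thesis unfolding W_def \<rho>(3) L_def \<eta>_def by simp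
      qed
      \<comment> \<open>Passing from \<open>c\<close> down to \<open>m s\<close> lowers the angular
        term by at most pi times the change, as \<open>th\<close> is at most pi, while by
        \<open>action_decrease\<close> it raises \<open>W\<close> by at least that much.\<close>
      have Wr: "W s + m s * th \<ge> L + \<eta>" if s: "0 < s" "s < \<rho>" for s
      proof -
        have "m s < c" using strict_mono[OF Y, of s \<rho>] s \<rho> ay by auto
        then have "th * (c - m s) \<le> pi * (c - m s)" using th by (intro mult_right_mono) auto
        moreover have "pi * (c - m s) \<le> W s - W \<rho>"
          using action_decrease[OF vm Y b ay(1) _ _ ay(4) s \<rho>(2), folded W_def] ay \<rho> by simp
        ultimately show ?thesis using W\<rho> by (simp add: algebra_simps)
      qed
      have near': "C * al + \<bar>norm (g s0) - a\<bar> \<le> \<eta>" using near by (simp add: al_def \<eta>_def)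
      have "L + \<eta> \<le> arc_length m g v s0 s1 + C * al + \<bar>norm (g s0) - a\<bar>"
      proof (cases "r = 0")
        case True
        have 1: "norm (g s0) + Y \<le> arc_length m g v s0 s1"
          using arc_length_ge_radial[OF g1] arc_length_ge_radial[OF g2] u gY True unfolding arc r_def by simp
        \<comment> \<open>There is no calibration at turning radius 0. Instead, \<open>Wr\<close> is
          used for small \<open>s\<close>, where its left-hand side exceeds a + Y by at most the
          error \<open>e\<close>.\<close>
        have "L + \<eta> \<le> a + Y"
        proof (rule field_le_epsilon)
          fix e :: real assume e: "0 < e"
          define e' where "e' = min (e / pi) (c / 2)"
          have e': "0 < e'" "e' < c" "e' * pi \<le> e"
            using e c0 by (auto simp: e'_def min_def field_simps)
          obtain s where s: "0 < s" "s < \<rho>" "m s = e'"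
            using radius_with_value[OF Y e'(1) _ \<rho>(1)] e' \<rho> by auto
          define H where "H t = integral {s/2..t} (radial_slope m (m s))" for t
          note H = radial_slope_primitive[OF s(1), where c = "m s", folded H_def]
          have "W s = 2 * (H a - H s) + (H Y - H a)"
            unfolding W_def using H(2) s \<rho> ay by simp
          moreover have "H a - H s \<le> a - s" "H Y - H a \<le> Y - a" using H(3)[of s a] H(3)[of a Y] s \<rho> ay by auto
          moreover have "m s * th \<le> e' * pi" unfolding s(3) using th e' by (intro mult_left_mono) auto
          ultimately have "W s + m s * th \<le> a + Y + e" using s(1) e'(3) by simp
          then show "L + \<eta> \<le> a + Y + e" using Wr[OF s(1,2)] by (rule order_trans[rotated])
        qed
        moreover have "0 \<le> C * al" using C al0 by simp
        ultimately show ?thesis using 1 by linarith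
      next
        case False
        then have r: "0 < r" "r < \<rho>" using \<open>\<not> \<rho> \<le> r\<close> by (auto simp: r_def)
        define H where "H t = integral {r/2..t} (radial_slope m (m r))" for t
        note H = radial_slope_primitive[OF r(1), where c = "m r", folded H_def]
        define w1 where "w1 = \<bar>integral {s0..u} (\<lambda>t. Im (v t / g t))\<bar>"
        define w2 where "w2 = \<bar>integral {u..s1} (\<lambda>t. Im (v t / g t))\<bar>"
        have low: "r \<le> norm (g t)" if "t \<in> {s0..s1}" for t using umin[OF that] by (simp add: r_def)
        have nz: "g t \<noteq> 0" if "t \<in> {s0..s1}" for t using low[OF that] r by auto
        have cm: "m r \<le> m (norm (g t))" if "t \<in> {s0..s1}" for t
          using mono[OF Y, of r "norm (g t)"] low[OF that] gY(1)[OF that] r by simp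
        have mr: "0 < m r" "m r < c" using pos r strict_mono[OF Y, of r \<rho>] \<rho> ay by auto
        have "\<bar>H (norm (g u)) - H (norm (g s0))\<bar> + m r * w1 \<le> arc_length m g v s0 u"
          unfolding w1_def by (rule arc_length_ge_calibration[OF g1 _ r(1)]) (use u low mr cm H(1) in auto)
        then have 1: "H (norm (g s0)) - H r + m r * w1 \<le> arc_length m g v s0 u" by (simp add: r_def)
        have "\<bar>H (norm (g s1)) - H (norm (g u))\<bar> + m r * w2 \<le> arc_length m g v u s1"
          unfolding w2_def by (rule arc_length_ge_calibration[OF g2 _ r(1)]) (use u low mr cm H(1) in auto)
        then have 2: "H Y - H r + m r * w2 \<le> arc_length m g v u s1" using gY by (simp add: r_def)
        have "\<bar>Arg (g u / q)\<bar> \<le> al + w1" unfolding al_def w1_def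
          using u nz by (intro polar_lift_arg[OF g1 _ _ q0]) auto
        moreover have "th \<le> \<bar>Arg (g u / q)\<bar> + w2" unfolding th_def w2_def
          using u nz by (intro polar_lift_arg[OF g2 _ _ q0]) auto
        ultimately have "m r * th \<le> m r * (al + w1 + w2)" using mr by (intro mult_left_mono) auto
        then have 3: "m r * th \<le> m r * al + m r * w1 + m r * w2" by (simp add: distrib_left)
        have 4: "m r * al \<le> C * al" using mr c al0 by (intro mult_right_mono) auto
        have 5: "W r = 2 * (H a - H r) + (H Y - H a)" unfolding W_def using H(2) r \<rho> ay by simp
        have "H a - H (norm (g s0)) \<le> \<bar>norm (g s0) - a\<bar>"
        proof (cases "a \<le> norm (g s0)")
          case True
          then show ?thesis using H(3)[of a "norm (g s0)"] r \<rho> by simp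
        next
          case False
          then show ?thesis using H(3)[of "norm (g s0)" a] rq by simp
        qed
        then have 6: "H a \<le> H (norm (g s0)) + \<bar>norm (g s0) - a\<bar>" by linarith
        have "L + \<eta> \<le> H a - H r + (H Y - H r) + m r * th" using Wr[OF r] unfolding 5 by (simp add: algebra_simps)
        also have "\<dots> \<le> H a - H r + (H Y - H r) + (C * al + m r * w1 + m r * w2)" using 3 4 by linarith
        also have "\<dots> \<le> arc_length m g v s0 s1 + C * al + \<bar>norm (g s0) - a\<bar>"
          unfolding arc using 1 2 6 by linarith
        finally show ?thesis .
      qed
      moreover have "0 \<le> C * al" using C al0 by simp
      ultimately show ?thesis using near' by linarith
    qed
  qed
  then show ?thesis using that c unfolding L_def al_def th_def by simp
qed

section \<open>Short initial pieces of a ray and exits from a disc\<close>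

lemma norm_diff_le_mdist: "\<bar>norm p - norm q\<bar> \<le> mdist m p q"
proof (rule field_le_epsilon)
  fix e :: real assume "0 < e"
  then have "mdist m p q < mdist m p q + e" by simp
  then obtain g v where g: "c1_curve g v 0 1" "g 0 = p" "g 1 = q" "arc_length m g v 0 1 < mdist m p q + e"
    by (rule near_minimal_curve)
  show "\<bar>norm p - norm q\<bar> \<le> mdist m p q + e" using arc_length_ge_radial[OF g(1)] g(2-) by simp
qed

text \<open>A curve from \<open>q\<close> to \<open>p\<close> shorter than e + e^2 < 2 e stays at
  radii within 2 e of \<open>a\<close>, where \<open>m\<close> is at least m (a - 2 e). The
  calibration with this constant bounds its rotation. The allowance e^2 is of higher order and does
  not affect the rate as \<open>e\<close> tends to 0.\<close>

lemma Arg_le_mdist: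
  assumes Y: "\<forall>t\<in>{0..Y}. deriv m t > 0" and q: "norm q = a" and e: "0 < e" "e < 1" "2 * e < a" "a + 2 * e \<le> Y"
    and d: "mdist m q p \<le> e"
  shows "m (a - 2 * e) * \<bar>Arg (p / q)\<bar> \<le> e + e\<^sup>2"
proof -
  have e2: "0 < e\<^sup>2" "e\<^sup>2 < e" using e by (auto simp: power2_eq_square)
  have "mdist m q p < e + e\<^sup>2" using d e2 by linarith
  then obtain g v where g: "c1_curve g v 0 1" "g 0 = q" "g 1 = p" "arc_length m g v 0 1 < e + e\<^sup>2"
    by (rule near_minimal_curve)
  have near: "\<bar>norm (g t) - a\<bar> \<le> 2 * e" if t: "t \<in> {0..1}" for t
  proof -
    have "c1_curve g v 0 t" "c1_curve g v t 1" using t by (auto intro: c1_curve_subset[OF g(1)])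
    then have "\<bar>norm (g t) - norm (g 0)\<bar> \<le> arc_length m g v 0 t" "0 \<le> arc_length m g v t 1"
      using t arc_length_ge_radial arc_length_nonneg by auto
    then show ?thesis using arc_length_combine[OF g(1), of t] t g e2 q by simp
  qed
  define r where "r = a - 2 * e"
  have r: "0 < r" using e by (simp add: r_def)
  have low: "r \<le> norm (g t)" "norm (g t) \<le> Y" if "t \<in> {0..1}" for t
    using near[OF that] e by (auto simp: r_def)
  have nz: "g t \<noteq> 0" if "t \<in> {0..1}" for t using low(1)[OF that] r by auto
  have cm: "m r \<le> m (norm (g t))" if "t \<in> {0..1}" for t
    using mono[OF Y, of r "norm (g t)"] low[OF that] r by simp
  define w where "w = \<bar>integral {0..1} (\<lambda>t. Im (v t / g t))\<bar>"
  have mr: "0 < m r" using pos r by simp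
  have "m r * w \<le> arc_length m g v 0 1"
    using arc_length_ge_calibration[OF g(1) _ r low(1) _ cm radial_slope_primitive(1)[OF r]] mr
    unfolding w_def by fastforce
  moreover have q0: "q \<noteq> 0" using q e by auto
  then have "\<bar>Arg (p / q)\<bar> \<le> w" using polar_lift_arg[OF g(1) _ nz q0] g(2,3) by (simp add: w_def)
  then have "m r * \<bar>Arg (p / q)\<bar> \<le> m r * w" using mr by simp
  ultimately show ?thesis using g(4) unfolding r_def by linarith
qed

text \<open>The parameters at radius \<open>Y\<close> form a nonempty compact set. An earlier point
  outside the disc would give a smaller element by the intermediate value theorem.\<close>

lemma first_exit:
  assumes "c1_curve g v 0 1" "norm (g 0) < Y" "Y < norm (g 1)"
  obtains s where "0 \<le> s" "s < 1" "norm (g s) = Y" "\<And>t. t \<in> {0..s} \<Longrightarrow> norm (g t) \<le> Y"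
proof -
  have cont: "continuous_on {0..1} (\<lambda>t. norm (g t))"
    using c1_curveD(3)[OF assms(1)] by (intro continuous_intros)
  define S where "S = {t \<in> {0..1}. norm (g t) = Y}"
  have "closed S" unfolding S_def by (rule continuous_closed_preimage_constant[OF cont]) simp
  then have "compact S" unfolding compact_eq_bounded_closed by (auto simp: S_def intro: bounded_subset[of "{0..1}"])
  moreover have "S \<noteq> {}" using IVT'[of "\<lambda>t. norm (g t)" 0 Y 1] cont assms by (auto simp: S_def)
  ultimately obtain s where s: "s \<in> S" "\<And>t. t \<in> S \<Longrightarrow> s \<le> t"
    using continuous_attains_inf[of S "\<lambda>t. t"] by auto
  have "norm (g t) \<le> Y" if t: "t \<in> {0..s}" for t
  proof (rule ccontr)
    assume "\<not> norm (g t) \<le> Y"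
    then obtain t' where t': "0 \<le> t'" "t' \<le> t" "norm (g t') = Y"
      using IVT'[of "\<lambda>t. norm (g t)" 0 Y t] continuous_on_subset[OF cont, of "{0..t}"] t s assms by (auto simp: S_def)
    then have "t' \<in> S" using t s by (auto simp: S_def)
    then have "t = s" using s(2) t' t by force
    then show False using \<open>\<not> norm (g t) \<le> Y\<close> s by (simp add: S_def)
  qed
  moreover have "s \<noteq> 1" using s assms by (auto simp: S_def)
  ultimately show ?thesis using that[of s] s by (auto simp: S_def)
qed

text \<open>The ray from \<open>q\<close> cannot start inward or tangentially: moving along it for a short time \<open>e\<close>
  turns by at most about \<open>e / m a\<close>, which shortens the distance to the far away points of the ray
  by at most about \<open>C e / m a\<close>, less than \<open>e\<close>.\<close>

lemma ray_starts_outward: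
  assumes vm: "von_mangoldt m" and Y: "\<forall>t\<in>{0..Y}. deriv m t > 0"
    and b: "0 < b" "b < 1/2" "\<forall>t\<in>{a..y}. deriv m t \<le> b"
    and ay: "0 < a" "a < y" "y < Y" "m a \<le> cos (pi * b) * m y"
    and q: "norm q = a" and ray: "is_ray m \<gamma>" "\<gamma> 0 = q"
  shows "0 < inner (vector_derivative \<gamma> (at 0 within {0..})) q"
proof (rule ccontr)
  define w where "w = vector_derivative \<gamma> (at 0 within {0..})"
  assume "\<not> ?thesis"
  then have wq: "inner w q \<le> 0" by (simp add: w_def)
  have q0: "q \<noteq> 0" using q ay by auto
  have ma: "0 < m a" using pos ay by simp
  have dist: "mdist m (\<gamma> s) (\<gamma> t) = \<bar>s - t\<bar>" if "0 \<le> s" "0 \<le> t" for s t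
    using ray(1) that unfolding is_ray_def by blast
  have "(\<gamma> has_vector_derivative w) (at 0 within {0..})"
    using ray(1) unfolding is_ray_def w_def by (simp add: vector_derivative_works)
  from norm_has_deriv[OF this] ray(2) q0
  have dn: "((\<lambda>t. norm (\<gamma> t)) has_real_derivative a * Re (w / q)) (at 0 within {0..})" using q by simp
  have "a * Re (w / q) \<le> 0"
    using wq inner_eq_Re_divide[OF q0, of w] q ay by (simp add: mult_le_0_iff)
  obtain C where C: "0 < C" "C < m a" "pi \<le> integral {a..Y} (turn_rate m C)"
    using turning_exceeds_pi[OF Y b ay] .
  obtain R where R: "0 < R" "R < a" "m R = C" using radius_with_value[OF Y C(1,2) ay(1)] .
  define \<eta> where "\<eta> = 2 * integral {R..a} (radial_slope m C)"
  have \<eta>: "0 < \<eta>"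
  proof -
    define H where "H t = integral {R/2..t} (radial_slope m C)" for t
    note H = radial_slope_primitive[OF R(1), where c = C, folded H_def]
    have "H R < H a"
    proof (rule DERIV_pos_imp_increasing_open[OF R(2)])
      fix r assume r: "R < r" "r < a"
      then have "C < m r" using strict_mono[OF Y, of R r] R ay by auto
      then show "\<exists>d. (H has_real_derivative d) (at r) \<and> 0 < d" using H(1)[of r] r C radial_slope_pos[of C m r] by auto
    next
      show "continuous_on {R..a} H" using H(1) by (intro DERIV_atLeastAtMost_imp_continuous_on) auto
    qed
    then show ?thesis unfolding \<eta>_def using H(2)[of R a] R by simp
  qed
  \<comment> \<open>The error budget for a step \<open>e\<close> along the ray: the rotation costs
    less than e (1 + \<kappa>) / 2, and the radial gain and the excess of the near-minimal curve
    each less than e (1 - \<kappa>) / 4. These add up to exactly \<open>e\<close>.\<close>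
  define \<kappa> where "\<kappa> = C / m a"
  have \<kappa>: "0 < \<kappa>" "\<kappa> < 1" using C ma by (auto simp: \<kappa>_def)
  \<comment> \<open>By \<open>Arg_le_mdist\<close> this quotient bounds \<open>C\<close> times the
    angle turned up to time \<open>e\<close>, divided by \<open>e\<close>.\<close>
  have "((\<lambda>e. C * (1 + e) / m (a - 2 * e)) \<longlongrightarrow> C * (1 + 0) / m (a - 2 * 0)) (at_right 0)"
    using ma by (intro tendsto_intros tendsto_compose[OF continuous[of UNIV, unfolded continuous_on_eq_continuous_at[OF open_UNIV] isCont_def, rule_format]])
      (auto intro!: tendsto_eq_intros)
  moreover have "C * (1 + 0) / m (a - 2 * 0) = \<kappa>" by (simp add: \<kappa>_def)
  then have "C * (1 + 0) / m (a - 2 * 0) < (1 + \<kappa>) / 2" using \<kappa> by simp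
  ultimately have ev1: "eventually (\<lambda>e. C * (1 + e) / m (a - 2 * e) < (1 + \<kappa>) / 2) (at_right 0)"
    by (rule order_tendstoD(2))
  have "((\<lambda>t. (norm (\<gamma> t) - a) / t) \<longlongrightarrow> a * Re (w / q)) (at_right 0)"
  proof -
    have "((\<lambda>t. (norm (\<gamma> t) - norm (\<gamma> 0)) / (t - 0)) \<longlongrightarrow> a * Re (w / q)) (at 0 within {0..})"
      using dn unfolding has_field_derivative_iff .
    moreover have "{0<..} \<subseteq> {0::real..}" by auto
    ultimately show ?thesis using tendsto_within_subset by (simp add: ray(2) q) blast
  qed
  moreover have "a * Re (w / q) < (1 - \<kappa>) / 4" using \<open>a * Re (w / q) \<le> 0\<close> \<kappa> by simp
  ultimately have ev2: "eventually (\<lambda>t. (norm (\<gamma> t) - a) / t < (1 - \<kappa>) / 4) (at_right 0)"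
    by (rule order_tendstoD(2))
  \<comment> \<open>The first entry lets the displacement of the starting point be absorbed by
    \<open>\<eta>\<close>, the others meet the conditions of \<open>Arg_le_mdist\<close> and keep
    \<open>\<gamma> e\<close> inside the disc of radius \<open>Y\<close>.\<close>
  define e0 where "e0 = min (min (\<eta> / 4) 1) (min (a / 4) ((Y - a) / 4))"
  have e0: "0 < e0" using \<eta> ay by (auto simp: e0_def)
  have ev3: "eventually (\<lambda>e. 0 < e \<and> e < e0) (at_right (0::real))"
    using e0 by (auto simp: eventually_at_right)
  obtain e where e1: "C * (1 + e) / m (a - 2 * e) < (1 + \<kappa>) / 2"
    and e2: "(norm (\<gamma> e) - a) / e < (1 - \<kappa>) / 4" and e3: "0 < e" "e < e0"
    using eventually_happens[OF eventually_conj[OF ev1 eventually_conj[OF ev2 ev3]]] by auto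
  have es: "4 * e < \<eta>" "e < 1" "2 * e < a" "a + 2 * e \<le> Y" "4 * e < Y - a" using e3 ay by (auto simp: e0_def)
  define al where "al = \<bar>Arg (\<gamma> e / q)\<bar>"
  define me where "me = m (a - 2 * e)"
  have me: "0 < me" unfolding me_def using pos es by simp
  have "me * al \<le> e + e\<^sup>2"
    unfolding me_def al_def using Arg_le_mdist[OF Y q e3(1) es(2-4), of "\<gamma> e"] dist[of 0 e] e3 ray(2) by simp
  then have "al \<le> (e + e\<^sup>2) / me" using me by (simp add: field_simps)
  then have "C * al \<le> C * ((e + e\<^sup>2) / me)" using C by (intro mult_left_mono) auto
  also have "\<dots> = e * (C * (1 + e) / me)" by (simp add: field_simps power2_eq_square)
  also have "\<dots> < e * ((1 + \<kappa>) / 2)" using e1 e3 unfolding me_def by (intro mult_strict_left_mono) auto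
  finally have Cal: "C * al < e * ((1 + \<kappa>) / 2)" .
  have "norm (\<gamma> e) - a < e * ((1 - \<kappa>) / 4)" using e2 e3 by (simp add: field_simps)
  moreover have "0 < e * ((1 - \<kappa>) / 4)" using e3 \<kappa> by simp
  ultimately have rad: "max 0 (norm (\<gamma> e) - a) < e * ((1 - \<kappa>) / 4)"
    unfolding max_less_iff_conj by blast
  have rad': "\<bar>norm (\<gamma> e) - a\<bar> \<le> e"
    using norm_diff_le_mdist[of "\<gamma> 0" "\<gamma> e"] dist[of 0 e] e3 ray(2) q by simp
  \<comment> \<open>The path through the pole has length a + norm (\<gamma> T), so at this time the
    ray is outside the disc of radius \<open>Y\<close>.\<close>
  define T where "T = a + Y + 1"
  have T: "e < T" "0 \<le> T" using es ay e3 by (auto simp: T_def)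
  have "T \<le> a + norm (\<gamma> T)"
    using dist[of 0 T] T mdist_le_via_pole[of "\<gamma> 0" "\<gamma> T"] ray(2) q by simp
  then have far: "Y < norm (\<gamma> T)" by (simp add: T_def)
  have "mdist m (\<gamma> e) (\<gamma> T) < T - e + e * ((1 - \<kappa>) / 4)"
    using dist[of e T] T e3 \<kappa> by simp
  then obtain g v where g: "c1_curve g v 0 1" "g 0 = \<gamma> e" "g 1 = \<gamma> T"
    "arc_length m g v 0 1 < T - e + e * ((1 - \<kappa>) / 4)"
    by (rule near_minimal_curve)
  have "norm (g 0) < Y" "Y < norm (g 1)" using g rad' es far by auto
  then obtain s where s: "0 \<le> s" "s < 1" "norm (g s) = Y" "\<And>t. t \<in> {0..s} \<Longrightarrow> norm (g t) \<le> Y"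
    using first_exit[OF g(1)] by blast
  have g1: "c1_curve g v 0 s" and g2: "c1_curve g v s 1" using s by (auto intro: c1_curve_subset[OF g(1)])
  have "e * ((1 + \<kappa>) / 2) \<le> e * 1" using e3 \<kappa> by (intro mult_left_mono) auto
  then have near: "C * \<bar>Arg (g 0 / q)\<bar> + \<bar>norm (g 0) - a\<bar> \<le> 2 * integral {R..a} (radial_slope m C)"
    using Cal rad' es e3 unfolding g(2) al_def[symmetric] \<eta>_def[symmetric] by linarith
  obtain c where c: "0 \<le> c" "c \<le> C" "\<bar>Arg (g s / q)\<bar> = integral {a..Y} (turn_rate m c)"
    "c * \<bar>Arg (g s / q)\<bar> + integral {a..Y} (radial_slope m c)
      \<le> arc_length m g v 0 s + C * \<bar>Arg (g 0 / q)\<bar> + max 0 (norm (g 0) - a)"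
    using curve_to_boundary[OF vm Y b ay C R q g1 s(1) s(4) s(3) near] .
  have cm: "\<forall>r\<in>{a..Y}. c < m r" 
  proof
    fix r assume "r \<in> {a..Y}"
    then have "m a \<le> m r" using mono[OF Y, of a r] ay by simp
    then show "c < m r" using C c by linarith
  qed
  obtain h u where h: "c1_curve h u a Y" "h a = q" "h Y = q * of_real (Y / a) * cis (Arg (g s / q))"
    "arc_length m h u a Y = c * \<bar>Arg (g s / q)\<bar> + integral {a..Y} (radial_slope m c)"
    using outward_geodesic[OF ay(1) _ c(1) cm q c(3)] ay by auto
  have "h Y = q * rcis (norm (g s / q)) (Arg (g s / q))"
    unfolding h(3) rcis_def using s q by (simp add: norm_divide)
  then have hY: "h Y = g s" using q0 by (simp add: rcis_cmod_Arg)
  \<comment> \<open>The outward geodesic from \<open>q\<close> to the exit point, followed by the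
    rest of the near-minimal curve, competes for the distance \<open>T\<close> from \<open>q\<close>
    to \<open>\<gamma> T\<close>.\<close>
  have "mdist m (h a) (g 1) \<le> arc_length m h u a Y + arc_length m g v s 1"
    using s ay by (intro mdist_le[OF h(1) _ g2 _ hY]) auto
  then have "T \<le> arc_length m h u a Y + arc_length m g v s 1"
    using dist[of 0 T] T ray(2) h(2) g(3) by simp
  also have "\<dots> \<le> arc_length m g v 0 1 + C * al + max 0 (norm (\<gamma> e) - a)"
    using c(4) arc_length_combine[OF g(1), of s] s unfolding h(4) g(2) al_def by simp
  also have "\<dots> < T - e + e * ((1 - \<kappa>) / 4) + e * ((1 + \<kappa>) / 2) + e * ((1 - \<kappa>) / 4)"
    using g(4) Cal rad by linarith
  also have "\<dots> = T" by (simp add: field_simps)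
  finally show False by simp
qed

end

section \<open>The radii of points of \<open>Cset\<close>\<close>

theorem theorem6p3:
  fixes m :: "real \<Rightarrow> real" and x y :: real
  assumes "von_mangoldt m"
    and "0 < x" and "x < y"
    and "\<forall>t\<in>{0..y}. deriv m t > 0"
    and "\<forall>t\<in>{x..y}. deriv m t < 1/2"
    and "x \<le> fmx m x y"
  shows "norm ` Cset m \<inter> {x..fmx m x y} = {}"
proof (rule ccontr)
  interpret smooth_profile m using assms(1) by unfold_locales (simp add: von_mangoldt_def)
  define b where "b = Sup (deriv m ` {x..y})"
  \<comment> \<open>The supremum is attained, so the pointwise strict bound 1/2 is inherited by
    \<open>b\<close>.\<close>
  obtain z where z: "z \<in> {x..y}" "\<And>t. t \<in> {x..y} \<Longrightarrow> deriv m t \<le> deriv m z"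
    using continuous_attains_sup[of "{x..y}" "deriv m"] deriv_continuous assms(3) by auto
  have bz: "b = deriv m z" unfolding b_def using z by (intro cSup_eq_maximum) auto
  have b: "0 < b" "b < 1/2" "\<forall>t\<in>{x..y}. deriv m t \<le> b" using z assms unfolding bz by auto
  have "0 < pi * b" "pi * b < pi / 2" using b by auto
  then have cosb: "0 < cos (pi * b)" "cos (pi * b) < 1"
    using cos_gt_zero_pi[of "pi * b"] cos_monotone_0_pi[of 0 "pi * b"] by auto
  have my: "0 < m y" using pos assms by simp
  define f where "f = fmx m x y"
  have "cos (pi * b) * m y \<in> m ` {0..y}"
  proof -
    have "cos (pi * b) * m y \<le> 1 * m y" using cosb my by (intro mult_right_mono) auto
    then obtain t where "0 \<le> t" "t \<le> y" "m t = cos (pi * b) * m y"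
      using IVT'[of m 0 "cos (pi * b) * m y" y] cosb my assms continuous by auto
    then show ?thesis by force
  qed
  note im = this
  have inj: "inj_on m {0..y}"
  proof (rule linorder_inj_onI)
    fix r s assume "r < s" "r \<in> {0..y}" "s \<in> {0..y}"
    then show "m r \<noteq> m s" using strict_mono[OF assms(4), of r s] by simp
  qed auto
  have mf: "m f = cos (pi * b) * m y"
    unfolding f_def fmx_def b_def[symmetric] by (rule f_the_inv_into_f[OF inj im])
  have fy: "f \<in> {0..y}"
    unfolding f_def fmx_def b_def[symmetric] by (rule the_inv_into_into[OF inj im order_refl])
  assume "\<not> ?thesis"
  then obtain q where qC: "q \<in> Cset m" and q: "x \<le> norm q" "norm q \<le> f" unfolding f_def by auto
  define a where "a = norm q"
  have a: "0 < a" using q(1) assms(2) unfolding a_def by linarith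
  have maf: "m a \<le> cos (pi * b) * m y"
    using mono[OF assms(4), of a f] q fy a unfolding mf a_def by simp
  have "m a < m y" using maf mult_strict_right_mono[OF cosb(2) my] by linarith
  then have ay: "a < y" using q fy unfolding a_def by (cases "norm q = y") auto
  \<comment> \<open>By continuity m' stays positive a little beyond \<open>y\<close>. This extra
    room yields the strict inequality inside \<open>turning_exceeds_pi\<close>.\<close>
  obtain Y where Y: "y < Y" "\<forall>t\<in>{0..Y}. deriv m t > 0"
  proof -
    have "isCont (deriv m) y" using deriv_has_deriv DERIV_isCont by blast
    then have lim: "(deriv m \<longlongrightarrow> deriv m y) (at y)" by (simp add: isCont_def)
    have "deriv m y > 0" using assms(2-4) by simp
    from order_tendstoD(1)[OF lim this]
    have "eventually (\<lambda>t. deriv m t > 0) (at y)" .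
    then obtain d where d: "d > 0" "\<And>t. t \<noteq> y \<Longrightarrow> dist t y < d \<Longrightarrow> deriv m t > 0"
      unfolding eventually_at by auto
    have "deriv m t > 0" if "t \<in> {0..y + d / 2}" for t
      using assms(4) d(2)[of t] that d(1) by (cases "t \<le> y") (auto simp: dist_real_def)
    then show ?thesis using that[of "y + d / 2"] d by auto
  qed
  have ba: "\<forall>t\<in>{a..y}. deriv m t \<le> b" using b q by (auto simp: a_def)
  have q0: "q \<noteq> 0" using a by (auto simp: a_def)
  \<comment> \<open>The direction that no ray approximates is \<open>- u\<close>, the unit vector
    pointing at the pole. Membership of \<open>q\<close> in \<open>Cset\<close> is tested on
    it.\<close>
  define u where "u = q / of_real a"
  have nu: "norm u = 1" using a by (simp add: u_def a_def norm_divide)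
  have g: "gmet m q (- u) w = - inner w u" for w
  proof -
    have "inner u u = 1" using nu by (simp add: power2_norm_eq_inner[symmetric])
    moreover have "inner u (\<i> * u) = 0" by (simp add: inner_complex_def)
    ultimately show ?thesis using q0 unfolding gmet_def Let_def a_def[symmetric] u_def[symmetric] by simp
  qed
  have g1: "gmet m q (- u) (- u) = 1" unfolding g using nu by (simp add: power2_norm_eq_inner[symmetric])
  then obtain \<gamma> where \<gamma>: "is_ray m \<gamma>" "\<gamma> 0 = q"
    and ang: "mangle m q (- u) (vector_derivative \<gamma> (at 0 within {0..})) \<le> pi / 2"
    using qC unfolding Cset_def by blast
  define w where "w = vector_derivative \<gamma> (at 0 within {0..})"
  have wq: "0 < inner w q"
    unfolding w_def using ray_starts_outward[OF assms(1) Y(2) b(1,2) ba a ay Y(1) maf _ \<gamma>] by (simp add: a_def)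
  have "inner w u = inner w q / a"
    using a by (simp add: u_def inner_complex_def add_divide_distrib)
  moreover have "inner w q \<le> a * speed m q w" using inner_le_speed[of w q m] by (simp add: a_def)
  \<comment> \<open>Outwardness gives the first bound. The second puts the quotient by the speed
    into (0, 1], so that arccos is applied inside its proper domain and the angle with
    \<open>- u\<close> exceeds pi / 2.\<close>
  ultimately have wu: "0 < inner w u" "inner w u \<le> speed m q w"
    using wq a by (simp_all add: pos_divide_le_eq mult.commute)
  then have sp: "0 < speed m q w" by simp
  have "mangle m q (- u) w = arccos (- (inner w u / speed m q w))"
    unfolding mangle_def g1 unfolding g speed_def by simp
  moreover have "arccos 0 < arccos (- (inner w u / speed m q w))"
    using wu sp by (intro arccos_less_arccos) (auto simp: field_simps)
  ultimately show False using ang unfolding w_def by simp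
qed

end
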